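(* Let $\Lambda$ be a probability measure on the set of probability measures on $\mathbb N=\{0,1,\ldots\}$, let $\mathbf P=\Lambda^{\otimes\mathbb N}$, and let $\boldsymbol\mu=(\mu_k)_{k\ge0}$ be distributed under $\mathbf P$. Let $\bar\mu_k$ and $\sigma_k^2$ be the mean and variance of $\mu_k$. Assume that $\bar\mu_0=1$ $\mathbf P$-almost surely and that $\sigma^2:=\mathbf E[\sigma_0^2]\in(0,\infty)$. Then $\mathbf P$-almost surely the environment $\boldsymbol\mu$ satisfies all of the following conditions, where the constant $c>0$ in (II) is deterministic under $\mathbf P$: (I) $\frac1n(\sigma_0^2+\cdots+\sigma_{n-1}^2)\to\sigma^2$ as $n\to\infty$ (and $\sigma^2>0$); (II) there exists a constant $c>0$ such that for all $0\le a<b$, $\displaystyle\liminf_{k\to\infty}\frac{\mu_{\lfloor ak\rfloor}(\{0\})+\cdots+\mu_{\lfloor bk\rfloor}(\{0\})}{(b-a)k}\ge c$; (III) there exists a sequence $(h_n)_{n\ge1}$ with $h_n\to+\infty$ such that for all $\varepsilon>0$, $\displaystyle\frac1{\sqrt n}\sum_{k=0}^{\lfloor h_n\sqrt n\rfloor}\mathrm E_{\boldsymbol\mu}\big[\xi_k^2\mathbf 1_{\{\xi_k^2\ge\varepsilon n\}}\big]\to0$ as $n\to\infty$, where $\xi_k\sim\mu_k$; (IV) $\mathrm P_{\boldsymbol\mu}$-almost surely, $\frac1n\sum_{k=0}^{n-1}\zeta_k\to\frac{\sigma^2}{2}$ as $n\to\infty$; (V) $\displaystyle\lim_{\varepsi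lon\to0}\limsup_{n\to\infty}\frac1n\sum_{k=0}^n\omega_k(\varepsilon)=0$.
   Context: $\mathrm P_{\boldsymbol\mu}$, $\mathrm E_{\boldsymbol\mu}$ denote the (quenched) probability and expectation given the environment $\boldsymbol\mu$. In (IV): for each $k\ge0$, $\bar\xi_k$ has the size-biased law of $\mu_k$, i.e. $\mathrm P_{\boldsymbol\mu}(\bar\xi_k=i)=i\,\mu_k(\{i\})$ for $i\ge0$, and given $\bar\xi_k$ the variable $\zeta_k$ is uniform on $\{0,\ldots,\bar\xi_k-1\}$; the family $(\zeta_k)_{k\ge0}$ is independent under $\mathrm P_{\boldsymbol\mu}$. In (V): for $s\in[0,1)$, $\varphi_k(s)=\frac1{1-f_k(s)}-\frac1{1-s}$, where $f_k$ is the generating function of $\mu_k$, and $\omega_k(\varepsilon)=\sup_{1-\varepsilon\le s\le t<1}|\varphi_k(s)-\varphi_k(t)|$. *)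

theory Defs
  imports "HOL-Probability.Probability"
begin

text \<open>
  Probability measures on the natural numbers are elements of
  \<open>space (prob_algebra (count_space UNIV))\<close>; the set of all of them carries the Giry
  \<open>\<sigma>\<close>-algebra, which is the one generated by the maps \<open>\<nu> \<mapsto> \<nu>({i})\<close>.
\<close>

abbreviation prob_measures_nat :: "nat measure measure" where
  "prob_measures_nat \<equiv> prob_algebra (count_space (UNIV :: nat set))"

definition environment_law :: "nat measure measure \<Rightarrow> (nat \<Rightarrow> nat measure) measure" where
  "environment_law \<Lambda> = PiM UNIV (\<lambda>_. \<Lambda>)"

text \<open>
  Means and variances are extended nonnegative reals, because the Bochner integral would return 0
  for an infinite one. When the mean is infinite, \<open>enn2real\<close> sends it to 0 and the variance
  below is infinite as well.
\<close>

definition mean :: "nat measure \<Rightarrow> ennreal" where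
  "mean \<nu> = (\<integral>\<^sup>+ i. of_nat i \<partial>\<nu>)"

definition var :: "nat measure \<Rightarrow> ennreal" where
  "var \<nu> = (\<integral>\<^sup>+ i. ennreal ((real i - enn2real (mean \<nu>))\<^sup>2) \<partial>\<nu>)"

definition gen_fun :: "nat measure \<Rightarrow> real \<Rightarrow> real" where
  "gen_fun \<nu> s = (\<Sum>i. measure \<nu> {i} * s ^ i)"

definition shape_fun :: "nat measure \<Rightarrow> real \<Rightarrow> real" where
  "shape_fun \<nu> s = 1 / (1 - gen_fun \<nu> s) - 1 / (1 - s)"

text \<open>
  The constraint \<open>0 \<le> s\<close> keeps the arguments in the domain \<open>[0,1)\<close> of
  \<open>shape_fun \<nu>\<close>; it only matters for \<open>\<epsilon> > 1\<close>.
\<close>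

definition shape_modulus :: "nat measure \<Rightarrow> real \<Rightarrow> ennreal" where
  "shape_modulus \<nu> \<epsilon> =
     (SUP (s, t) \<in> {(s, t). 0 \<le> s \<and> 1 - \<epsilon> \<le> s \<and> s \<le> t \<and> t < 1}.
        ennreal \<bar>shape_fun \<nu> s - shape_fun \<nu> t\<bar>)"

text \<open>The measure with mass \<open>i * \<nu>({i})\<close> at \<open>i\<close>; a probability measure iff the mean is 1.\<close>

definition size_biased :: "nat measure \<Rightarrow> nat measure" where
  "size_biased \<nu> = density \<nu> of_nat"

text \<open>
  The law of \<open>\<zeta>\<close>, where \<open>\<xi>\<close> is size-biased and \<open>\<zeta>\<close> is uniform on \<open>{0,...,\<xi>-1}\<close> given
  \<open>\<xi>\<close>. The unspecified value \<open>pmf_of_set {}\<close> at \<open>\<xi> = 0\<close> is irrelevant, since the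
  size-biased law gives no mass to 0.
\<close>

definition zeta_law :: "nat measure \<Rightarrow> nat measure" where
  "zeta_law \<nu> = size_biased \<nu> \<bind> (\<lambda>i. measure_pmf (pmf_of_set {..<i}))"

text \<open>The quenched law of the independent family \<open>(\<zeta>\<^sub>k)\<close> in the environment \<open>\<mu>\<close>.\<close>

definition quenched_zeta_law :: "(nat \<Rightarrow> nat measure) \<Rightarrow> (nat \<Rightarrow> nat) measure" where
  "quenched_zeta_law \<mu> = PiM UNIV (\<lambda>k. zeta_law (\<mu> k))"

end

theory Submission
  imports Defs
begin

text \<open>
  Everything follows from a strong law of large numbers for independent, nonnegative, not
  necessarily identically distributed variables \<open>X\<^sub>k\<close>, proved by Etemadi's method: if
  \<open>\<Sum>\<^sub>k E[min(1, X\<^sub>k/(k+1))\<^sup>2]\<close> is finite, then almost surely \<open>X\<^sub>k\<close> is eventually equal to its truncation at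
  \<open>k + 1\<close>, and the squared deviations of the averages of the truncated variables are summable along every
  geometric subsequence; monotonicity of the partial sums fills the gaps. Since
  \<open>\<Sum>\<^sub>k min(1, x/(k+1))\<^sup>2 \<le> 4x\<close>, the condition holds for i.i.d. integrable variables, hence for functions
  of the \<open>\<mu>\<^sub>k\<close>; by Fubini it also holds for the \<open>\<zeta>\<^sub>k\<close> in almost every environment, which yields (IV).

  (I) and (II) are direct applications, with \<open>c = E[\<mu>\<^sub>0({0})]\<close>: this is positive, since a law of mean 1
  without mass at 0 is degenerate. For (III), the averages of \<open>E\<^sub>\<mu>[\<xi>\<^sub>k\<^sup>2; \<xi>\<^sub>k\<^sup>2 \<ge> L]\<close> converge to limits that
  vanish as \<open>L\<close> grows, so the windows of length \<open>K \<surd>n\<close> are negligible for every \<open>K\<close>, and \<open>h\<close> is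
  obtained by a diagonal argument. For (V), \<open>\<omega>\<^sub>k(\<epsilon>)\<close> is bounded by a measurable function of \<open>\<mu>\<^sub>k\<close>
  dominated by \<open>2 \<sigma>\<^sub>k\<^sup>2\<close> and tending to 0 with \<open>\<epsilon>\<close>.
\<close>

section \<open>Geometric subsequences and averages\<close>

text \<open>The sum telescopes: \<open>min 1 (x / (k+1))\<close> is at most
  \<open>2 * x / (x + k + 1)\<close>, and the square of that is at most the decrease of
  \<open>4 * x^2 / (x + k)\<close> from \<open>k\<close> to \<open>k+1\<close>. This potential,
  added to the sum in the induction, equals \<open>4 * x\<close> at \<open>k = 0\<close>.\<close>

lemma sum_min_square_le:
  assumes "0 \<le> (x::real)"
  shows "(\<Sum>k<n. (min 1 (x / real (Suc k)))\<^sup>2) \<le> 4 * x"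
proof (cases "x = 0")
  case False
  with assms have x: "0 < x" by simp
  have "(\<Sum>k<n. (min 1 (x / real (Suc k)))\<^sup>2) + 4 * x\<^sup>2 / (x + real n) \<le> 4 * x"
  proof (induction n)
    case 0
    then show ?case using x by (simp add: power2_eq_square)
  next
    case (Suc n)
    have "min 1 (x / real (Suc n)) \<le> 2 * x / (x + real (Suc n))"
    proof (cases "x \<le> real (Suc n)")
      case True
      then have "x * x \<le> x * real (Suc n)" using x by (intro mult_left_mono) auto
      then have "x / real (Suc n) \<le> 2 * x / (x + real (Suc n))"
        using x by (simp add: field_simps)
      then show ?thesis by simp
    next
      case False
      then have "1 \<le> 2 * x / (x + real (Suc n))" using x by (simp add: field_simps)
      then show ?thesis by simp
    qed
    then have "(min 1 (x / real (Suc n)))\<^sup>2 \<le> (2 * x / (x + real (Suc n)))\<^sup>2"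
      using x by (intro power_mono) auto
    also have "\<dots> = 4 * x\<^sup>2 / ((x + real (Suc n)) * (x + real (Suc n)))"
      by (simp add: power2_eq_square)
    also have "\<dots> \<le> 4 * x\<^sup>2 / ((x + real n) * (x + real (Suc n)))"
      using x by (intro divide_left_mono mult_right_mono) (auto intro!: mult_pos_pos add_pos_nonneg)
    also have "\<dots> = 4 * x\<^sup>2 / (x + real n) - 4 * x\<^sup>2 / (x + real (Suc n))"
      using x by (simp add: field_simps add_pos_nonneg)
    finally show ?case using Suc by simp
  qed
  moreover have "0 \<le> 4 * x\<^sup>2 / (x + real n)" using x by simp
  ultimately show ?thesis by linarith
qed simp

definition geom_idx :: "real \<Rightarrow> nat \<Rightarrow> nat" where
  "geom_idx \<alpha> n = nat \<lceil>\<alpha> ^ n\<rceil>"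

lemma geom_idx_bounds:
  assumes "1 < \<alpha>"
  shows "\<alpha> ^ n \<le> real (geom_idx \<alpha> n)" "real (geom_idx \<alpha> n) \<le> \<alpha> ^ n + 1"
    "real (geom_idx \<alpha> n) \<le> 2 * \<alpha> ^ n" "0 < geom_idx \<alpha> n"
proof -
  have 1: "1 \<le> \<alpha> ^ n" using assms by simp
  then have "0 \<le> \<lceil>\<alpha> ^ n\<rceil>" by linarith
  then have "real (geom_idx \<alpha> n) = of_int \<lceil>\<alpha> ^ n\<rceil>" unfolding geom_idx_def by simp
  then show 2: "\<alpha> ^ n \<le> real (geom_idx \<alpha> n)" "real (geom_idx \<alpha> n) \<le> \<alpha> ^ n + 1" by linarith+
  show "real (geom_idx \<alpha> n) \<le> 2 * \<alpha> ^ n" using 1 2 by linarith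
  have "0 < real (geom_idx \<alpha> n)" using 1 2 by linarith
  then show "0 < geom_idx \<alpha> n" by simp
qed

lemma geom_idx_at_top:
  assumes "1 < \<alpha>"
  shows "filterlim (geom_idx \<alpha>) at_top sequentially"
proof -
  have "filterlim (\<lambda>n. \<alpha> ^ n) at_top sequentially"
    using filterlim_realpow_sequentially_gt1[of \<alpha>] assms
    by (intro filterlim_at_infinity_imp_filterlim_at_top) auto
  then have "filterlim (\<lambda>n. real (geom_idx \<alpha> n)) at_top sequentially"
    by (rule filterlim_at_top_mono) (auto intro: always_eventually geom_idx_bounds(1) assms)
  then show ?thesis by (simp add: filterlim_sequentially_iff_filterlim_real)
qed

text \<open>From the first \<open>N\<close> with \<open>k < geom_idx \<alpha> N\<close> on, the
  index at \<open>N + i\<close> is at least \<open>(k+1)/2 * \<alpha>^i\<close>, so a geometric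
  series with ratio \<open>1/\<alpha>^2\<close> dominates. This is the cost of swapping the sums in
  the variance estimate along a geometric subsequence.\<close>

lemma geom_idx_tail_sum:
  assumes \<alpha>: "1 < \<alpha>"
  shows "(\<Sum>n. ennreal (of_bool (k < geom_idx \<alpha> n) / (real (geom_idx \<alpha> n))\<^sup>2))
    \<le> ennreal (4 / (1 - inverse (\<alpha>\<^sup>2)) / (real (Suc k))\<^sup>2)"
proof -
  let ?q = "inverse (\<alpha>\<^sup>2)" and ?K = "geom_idx \<alpha>"
  let ?t = "\<lambda>n. of_bool (k < ?K n) / (real (?K n))\<^sup>2"
  have q: "0 < ?q" "?q < 1" using \<alpha> by (auto simp: one_less_power inverse_less_1_iff)
  have "\<forall>\<^sub>F n in sequentially. Suc k \<le> ?K n"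
    using geom_idx_at_top[OF \<alpha>] by (simp add: filterlim_at_top)
  then have "\<exists>n. k < ?K n" by (auto simp: eventually_sequentially Suc_le_eq)
  define N where "N = (LEAST n. k < ?K n)"
  have N: "k < ?K N" unfolding N_def using \<open>\<exists>n. k < ?K n\<close> by (rule LeastI_ex)
  have N': "\<not> k < ?K n" if "n < N" for n using that unfolding N_def by (rule not_less_Least)
  \<comment> \<open>Rounding up costs at most a factor 2; squared, it is the 4 in the bound.\<close>
  have aN: "real (Suc k) \<le> 2 * \<alpha> ^ N" using N geom_idx_bounds(3)[OF \<alpha>, of N] by linarith
  have t: "?t (N + i) \<le> 4 / (real (Suc k))\<^sup>2 * ?q ^ i" for i
  proof -
    have *: "0 < real (Suc k) / 2 * \<alpha> ^ i" using \<alpha> by simp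
    have "real (Suc k) / 2 * \<alpha> ^ i \<le> \<alpha> ^ N * \<alpha> ^ i"
      using aN \<alpha> by (intro mult_right_mono) auto
    also have "\<dots> \<le> real (?K (N + i))" using geom_idx_bounds(1)[OF \<alpha>, of "N + i"] by (simp add: power_add)
    finally have "(real (Suc k) / 2 * \<alpha> ^ i)\<^sup>2 \<le> (real (?K (N + i)))\<^sup>2"
      using * by (intro power_mono) auto
    then have "1 / (real (?K (N + i)))\<^sup>2 \<le> 1 / (real (Suc k) / 2 * \<alpha> ^ i)\<^sup>2"
      using zero_less_power[OF *, of 2] by (intro frac_le zero_le_one order_refl)
    also have "\<dots> = 4 / (real (Suc k))\<^sup>2 * ?q ^ i"
      by (simp add: field_simps power_mult_distrib power2_eq_square)
    finally show ?thesis by (auto simp: of_bool_def)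
  qed
  have "(\<Sum>n<m. ?t n) \<le> 4 / (1 - ?q) / (real (Suc k))\<^sup>2" for m
  proof -
    have "(\<Sum>n<m. ?t n) \<le> (\<Sum>n<N + m. ?t n)" by (intro sum_mono2) auto
    also have "\<dots> = (\<Sum>n<N. ?t n) + (\<Sum>i<m. ?t (N + i))"
      by (induction m) auto
    also have "(\<Sum>n<N. ?t n) = 0" using N' by (intro sum.neutral) auto
    also have "0 + (\<Sum>i<m. ?t (N + i)) \<le> (\<Sum>i<m. 4 / (real (Suc k))\<^sup>2 * ?q ^ i)"
      using t by (auto intro: sum_mono)
    also have "\<dots> = 4 / (real (Suc k))\<^sup>2 * (\<Sum>i<m. ?q ^ i)" by (simp add: sum_distrib_left)
    also have "\<dots> \<le> 4 / (real (Suc k))\<^sup>2 * (1 / (1 - ?q))"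
    proof (intro mult_left_mono)
      show "(\<Sum>i<m. ?q ^ i) \<le> 1 / (1 - ?q)"
        using q by (subst sum_gp_strict) (auto intro!: divide_right_mono)
    qed simp
    finally show ?thesis by (simp add: mult.commute)
  qed
  then show ?thesis
    by (intro suminf_le_const) (auto simp: sum_ennreal intro!: ennreal_leI)
qed

text \<open>By monotonicity \<open>S n\<close> lies between its values at neighbouring geometric
  indices, so all limit points of \<open>S n / n\<close> lie between \<open>m / \<alpha>\<close> and
  \<open>m * \<alpha>\<close>. The ratios \<open>1 + 1/(j+1)\<close> bring \<open>\<alpha>\<close>
  down to 1.\<close>

lemma average_tendsto_of_geom_idx:
  fixes S :: "nat \<Rightarrow> real"
  assumes mono: "incseq S" and nonneg: "\<And>n. 0 \<le> S n"
    and lim: "\<And>j. (\<lambda>n. S (geom_idx (1 + 1 / real (Suc j)) n) / real (geom_idx (1 + 1 / real (Suc j)) n))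
        \<longlonglongrightarrow> m"
  shows "(\<lambda>n. S n / real n) \<longlonglongrightarrow> m"
proof -
  define \<alpha> where "\<alpha> j = 1 + 1 / real (Suc j)" for j
  define a where "a j i = S (geom_idx (\<alpha> j) i) / real (geom_idx (\<alpha> j) i)" for j i
  \<comment> \<open>For \<open>n\<close> at least 1, this is the exponent of the geometric block
    containing \<open>n\<close>.\<close>
  define l where "l j n = nat \<lfloor>log (\<alpha> j) (real n)\<rfloor>" for j n
  have \<alpha>1: "1 < \<alpha> j" for j by (simp add: \<alpha>_def)
  have \<alpha>lim: "\<alpha> \<longlonglongrightarrow> 1"
    unfolding \<alpha>_def using tendsto_add[OF tendsto_const LIMSEQ_inverse_real_of_nat, of 1]
    by (simp add: inverse_eq_divide)
  have alim: "a j \<longlonglongrightarrow> m" for j using lim[of j] unfolding a_def \<alpha>_def .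
  have l_top: "filterlim (l j) at_top sequentially" for j
  proof -
    have "filterlim (\<lambda>n. inverse (ln (\<alpha> j)) * ln (real n)) at_top sequentially"
      using \<alpha>1[of j]
      by (intro filterlim_tendsto_pos_mult_at_top[OF tendsto_const]
          filterlim_compose[OF ln_at_top filterlim_real_sequentially]) auto
    then have "filterlim (\<lambda>n. log (\<alpha> j) (real n)) at_top sequentially"
      by (simp add: log_def divide_inverse mult.commute)
    then show ?thesis unfolding l_def
      by (intro filterlim_compose[OF filterlim_nat_sequentially] filterlim_compose[OF filterlim_floor_sequentially])
  qed
  have l_bounds: "\<alpha> j ^ l j n \<le> real n" "real n < \<alpha> j ^ Suc (l j n)" if "1 \<le> n" for j n
  proof -
    have 0: "0 \<le> log (\<alpha> j) (real n)" using that \<alpha>1[of j] by simp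
    then have l: "real (l j n) \<le> log (\<alpha> j) (real n)" "log (\<alpha> j) (real n) < real (Suc (l j n))"
      unfolding l_def by linarith+
    have e: "\<alpha> j powr log (\<alpha> j) (real n) = real n" using that \<alpha>1[of j] by simp
    show "\<alpha> j ^ l j n \<le> real n"
      using powr_mono[OF l(1), of "\<alpha> j"] \<alpha>1[of j] e by (simp add: powr_realpow)
    show "real n < \<alpha> j ^ Suc (l j n)"
      using powr_less_mono[OF l(2), of "\<alpha> j"] \<alpha>1[of j] e by (simp add: powr_realpow del: power_Suc of_nat_Suc)
  qed
  have upper: "S n / real n \<le> a j (Suc (l j n)) * (\<alpha> j + inverse (\<alpha> j) ^ l j n)" if "1 \<le> n" for j n
  proof -
    let ?i = "l j n" and ?K = "geom_idx (\<alpha> j)"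
    have p: "0 < \<alpha> j ^ ?i" using \<alpha>1[of j] by simp
    have "real n \<le> real (?K (Suc ?i))"
      using l_bounds(2)[OF that, of j] geom_idx_bounds(1)[OF \<alpha>1, of j "Suc ?i"] by linarith
    then have "S n \<le> S (?K (Suc ?i))" using mono by (auto intro: incseqD)
    then have "S n / real n \<le> S (?K (Suc ?i)) / \<alpha> j ^ ?i"
      using l_bounds(1)[OF that, of j] p nonneg by (intro frac_le) auto
    also have "\<dots> = a j (Suc ?i) * (real (?K (Suc ?i)) / \<alpha> j ^ ?i)"
      using geom_idx_bounds(4)[OF \<alpha>1, of j "Suc ?i"] by (simp add: a_def)
    also have "\<dots> \<le> a j (Suc ?i) * ((\<alpha> j ^ Suc ?i + 1) / \<alpha> j ^ ?i)"
      using nonneg p geom_idx_bounds(2)[OF \<alpha>1, of j "Suc ?i"]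
      by (intro mult_left_mono divide_right_mono) (auto simp: a_def)
    \<comment> \<open>Rounding the index up adds at most 1, which leaves a term that vanishes as the
      block number grows.\<close>
    also have "(\<alpha> j ^ Suc ?i + 1) / \<alpha> j ^ ?i = \<alpha> j + inverse (\<alpha> j) ^ ?i"
      using p by (simp add: add_divide_distrib power_one_over inverse_eq_divide)
    finally show ?thesis .
  qed
  have lower: "a j (l j n) / \<alpha> j \<le> S n / real n" if "1 \<le> n" for j n
  proof -
    let ?i = "l j n" and ?K = "geom_idx (\<alpha> j)"
    have p: "0 < \<alpha> j ^ ?i" using \<alpha>1[of j] by simp
    have "\<lceil>\<alpha> j ^ ?i\<rceil> \<le> int n" using l_bounds(1)[OF that, of j] by linarith
    then have K: "?K ?i \<le> n" unfolding geom_idx_def by linarith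
    have "a j ?i / \<alpha> j = S (?K ?i) / (real (?K ?i) * \<alpha> j)" by (simp add: a_def)
    also have "\<dots> \<le> S (?K ?i) / \<alpha> j ^ Suc ?i"
      using nonneg p \<alpha>1[of j] geom_idx_bounds(1)[OF \<alpha>1, of j ?i]
      by (intro divide_left_mono) (auto simp: mult.commute geom_idx_bounds(4))
    also have "\<dots> \<le> S n / real n"
      using K mono l_bounds(2)[OF that, of j] that nonneg by (intro frac_le) (auto intro: incseqD)
    finally show ?thesis .
  qed
  have lim_upper: "(\<lambda>n. a j (Suc (l j n)) * (\<alpha> j + inverse (\<alpha> j) ^ l j n)) \<longlonglongrightarrow> m * (\<alpha> j + 0)" for j
    using \<alpha>1[of j]
    by (intro tendsto_intros filterlim_compose[OF LIMSEQ_Suc[OF alim] l_top]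
          filterlim_compose[OF LIMSEQ_realpow_zero l_top]) (auto simp: inverse_less_1_iff)
  have lim_lower: "(\<lambda>n. a j (l j n) / \<alpha> j) \<longlonglongrightarrow> m / \<alpha> j" for j
    using \<alpha>1[of j] by (intro tendsto_intros filterlim_compose[OF alim l_top]) auto
  show ?thesis
  proof (rule order_tendstoI)
    fix u assume "m < u"
    moreover have "(\<lambda>j. m * (\<alpha> j + 0)) \<longlonglongrightarrow> m * (1 + 0)" by (intro tendsto_intros \<alpha>lim)
    ultimately obtain j where "m * (\<alpha> j + 0) < u"
      by (metis (no_types, lifting) add.right_neutral eventually_happens' mult.right_neutral
          order_tendstoD(2) sequentially_bot)
    from order_tendstoD(2)[OF lim_upper this] eventually_ge_at_top[of 1]
    show "\<forall>\<^sub>F n in sequentially. S n / real n < u"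
      by eventually_elim (use upper[of _ j] in \<open>auto intro: le_less_trans\<close>)
  next
    fix u assume "u < m"
    moreover have "(\<lambda>j. m / \<alpha> j) \<longlonglongrightarrow> m / 1" by (intro tendsto_intros \<alpha>lim) auto
    ultimately obtain j where "u < m / \<alpha> j"
      by (metis (no_types, lifting) div_by_1 eventually_happens' order_tendstoD(1) sequentially_bot)
    from order_tendstoD(1)[OF lim_lower this] eventually_ge_at_top[of 1]
    show "\<forall>\<^sub>F n in sequentially. u < S n / real n"
      by eventually_elim (use lower[of _ j] in \<open>auto intro: less_le_trans\<close>)
  qed
qed

text \<open>For a fixed \<open>L\<close> the first \<open>L\<close> terms disappear in the average,
  so the limit superior is at most \<open>\<delta> L\<close>; then \<open>L\<close> is arbitrary. In
  the strong law, \<open>d k\<close> is the mean lost by truncating at \<open>k + 1\<close>, and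
  \<open>t L k\<close> the mean lost by truncating at the fixed level \<open>L\<close>.\<close>

lemma average_tendsto_zero_dominated:
  fixes d :: "nat \<Rightarrow> real"
  assumes nonneg: "\<And>k. 0 \<le> d k" "\<And>L k. 0 \<le> t L k"
    and dom: "\<And>L k. L \<le> k \<Longrightarrow> d k \<le> t L k"
    and lim: "\<And>L. (\<lambda>n. (\<Sum>k<n. t L k) / real n) \<longlonglongrightarrow> \<delta> L"
    and "\<delta> \<longlonglongrightarrow> 0"
  shows "(\<lambda>n. (\<Sum>k<n. d k) / real n) \<longlonglongrightarrow> 0"
proof (rule order_tendstoI)
  fix e :: real assume "0 < e"
  with \<open>\<delta> \<longlonglongrightarrow> 0\<close> obtain L where L: "\<delta> L < e"
    by (metis eventually_happens' order_tendstoD(2) sequentially_bot)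
  have le: "(\<Sum>k<n. d k) / real n \<le> (\<Sum>k<L. d k) * inverse (real n) + (\<Sum>k<n. t L k) / real n" for n
  proof -
    have "(\<Sum>k<n. d k) \<le> (\<Sum>k<n. (if k < L then d k else 0) + t L k)"
      using nonneg dom by (intro sum_mono) (auto simp: not_less)
    also have "\<dots> = (\<Sum>k<n. if k < L then d k else 0) + (\<Sum>k<n. t L k)" by (simp add: sum.distrib)
    also have "(\<Sum>k<n. if k < L then d k else 0) = (\<Sum>k\<in>{..<n} \<inter> {..<L}. d k)"
      by (intro sum.mono_neutral_cong_right) auto
    also have "\<dots> \<le> (\<Sum>k<L. d k)" using nonneg by (intro sum_mono2) auto
    finally have "(\<Sum>k<n. d k) / real n \<le> ((\<Sum>k<L. d k) + (\<Sum>k<n. t L k)) / real n"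
      by (intro divide_right_mono) auto
    then show ?thesis by (simp add: divide_inverse distrib_right)
  qed
  have "(\<lambda>n. (\<Sum>k<L. d k) * inverse (real n) + (\<Sum>k<n. t L k) / real n) \<longlonglongrightarrow> (\<Sum>k<L. d k) * 0 + \<delta> L"
    by (intro tendsto_intros lim lim_inverse_n)
  then have "\<forall>\<^sub>F n in sequentially. (\<Sum>k<L. d k) * inverse (real n) + (\<Sum>k<n. t L k) / real n < e"
    using L by (intro order_tendstoD(2)) auto
  then show "\<forall>\<^sub>F n in sequentially. (\<Sum>k<n. d k) / real n < e"
    by eventually_elim (use le in \<open>auto intro: le_less_trans\<close>)
next
  fix e :: real assume "e < 0"
  then show "\<forall>\<^sub>F n in sequentially. e < (\<Sum>k<n. d k) / real n"
    by (intro always_eventually allI) (auto intro!: less_le_trans[OF _ divide_nonneg_nonneg] sum_nonneg nonneg)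
qed

section \<open>The strong law of large numbers\<close>

text \<open>Independence kills the cross terms of the centered variables, and a variance is at most
  the second moment. The bounds \<open>c k\<close> make all products integrable; nonnegative
  integrals let the result be summed later without summability conditions.\<close>

lemma (in prob_space) second_moment_indep_sum_le:
  fixes Y :: "nat \<Rightarrow> 'a \<Rightarrow> real"
  assumes indep: "indep_vars (\<lambda>_. borel) Y UNIV"
    and bdd: "\<And>k \<omega>. \<bar>Y k \<omega>\<bar> \<le> c k"
  shows "(\<integral>\<^sup>+\<omega>. ennreal ((\<Sum>k<n. Y k \<omega> - expectation (Y k))\<^sup>2) \<partial>M)
      \<le> (\<Sum>k<n. \<integral>\<^sup>+\<omega>. ennreal ((Y k \<omega>)\<^sup>2) \<partial>M)"
proof -
  have [measurable]: "random_variable borel (Y k)" for k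
    using indep by (auto simp: indep_vars_def)
  define Z where "Z k \<omega> = Y k \<omega> - expectation (Y k)" for k \<omega>
  have intY: "integrable M (Y k)" for k
    by (rule integrable_const_bound[of _ "c k"]) (use bdd in auto)
  have [measurable]: "random_variable borel (Z k)" for k unfolding Z_def by simp
  have indepZ: "indep_vars (\<lambda>_. borel) Z UNIV"
    unfolding Z_def by (rule indep_vars_compose2[OF indep]) simp
  have bddZ: "\<bar>Z k \<omega>\<bar> \<le> c k + \<bar>expectation (Y k)\<bar>" for k \<omega>
    using bdd[of k \<omega>] unfolding Z_def by linarith
  have intZ: "integrable M (Z k)" for k unfolding Z_def using intY by simp
  have intY2: "integrable M (\<lambda>\<omega>. (Y k \<omega>)\<^sup>2)" for k
    by (rule integrable_const_bound[of _ "(c k)\<^sup>2"]) (use power_mono[OF bdd, of k _ 2] in auto)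
  have intZZ: "integrable M (\<lambda>\<omega>. Z i \<omega> * Z j \<omega>)" for i j
  proof (rule integrable_const_bound)
    show "AE \<omega> in M. norm (Z i \<omega> * Z j \<omega>)
        \<le> (c i + \<bar>expectation (Y i)\<bar>) * (c j + \<bar>expectation (Y j)\<bar>)"
      using bddZ by (auto simp: abs_mult intro!: mult_mono order_trans[OF abs_ge_zero bddZ])
  qed simp
  have EZ: "expectation (Z k) = 0" for k unfolding Z_def using intY by (simp add: prob_space)
  have orth: "expectation (\<lambda>\<omega>. Z i \<omega> * Z j \<omega>) = 0" if "i \<noteq> j" for i j
  proof -
    have "expectation (\<lambda>\<omega>. \<Prod>k\<in>{i, j}. Z k \<omega>) = (\<Prod>k\<in>{i, j}. expectation (Z k))"
      using intZ by (intro indep_vars_lebesgue_integral indep_vars_subset[OF indepZ]) auto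
    then show ?thesis using that EZ by simp
  qed
  have diag: "expectation (\<lambda>\<omega>. Z k \<omega> * Z k \<omega>) \<le> expectation (\<lambda>\<omega>. (Y k \<omega>)\<^sup>2)" for k
  proof -
    have "expectation (\<lambda>\<omega>. Z k \<omega> * Z k \<omega>) = expectation (\<lambda>\<omega>. (Y k \<omega>)\<^sup>2) - (expectation (Y k))\<^sup>2"
      using variance_eq[OF intY intY2, of k] by (simp add: Z_def power2_eq_square)
    then show ?thesis by simp
  qed
  have sq: "(\<Sum>k<n. Z k \<omega>)\<^sup>2 = (\<Sum>i<n. \<Sum>j<n. Z i \<omega> * Z j \<omega>)" for \<omega>
    by (simp add: power2_eq_square sum_product)
  have "expectation (\<lambda>\<omega>. (\<Sum>k<n. Z k \<omega>)\<^sup>2) = (\<Sum>i<n. \<Sum>j<n. expectation (\<lambda>\<omega>. Z i \<omega> * Z j \<omega>))"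
    using intZZ by (simp add: sq Bochner_Integration.integral_sum)
  also have "\<dots> = (\<Sum>i<n. \<Sum>j<n. if i = j then expectation (\<lambda>\<omega>. Z i \<omega> * Z j \<omega>) else 0)"
    using orth by (intro sum.cong refl) auto
  also have "\<dots> = (\<Sum>i<n. expectation (\<lambda>\<omega>. Z i \<omega> * Z i \<omega>))" by simp
  also have "\<dots> \<le> (\<Sum>i<n. expectation (\<lambda>\<omega>. (Y i \<omega>)\<^sup>2))" by (intro sum_mono diag)
  finally have le: "expectation (\<lambda>\<omega>. (\<Sum>k<n. Z k \<omega>)\<^sup>2) \<le> (\<Sum>i<n. expectation (\<lambda>\<omega>. (Y i \<omega>)\<^sup>2))" .
  have "(\<integral>\<^sup>+\<omega>. ennreal ((\<Sum>k<n. Z k \<omega>)\<^sup>2) \<partial>M) = ennreal (expectation (\<lambda>\<omega>. (\<Sum>k<n. Z k \<omega>)\<^sup>2))"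
    unfolding sq using intZZ
    by (intro nn_integral_eq_integral Bochner_Integration.integrable_sum AE_I2)
      (auto simp: sq[symmetric])
  also have "\<dots> \<le> ennreal (\<Sum>i<n. expectation (\<lambda>\<omega>. (Y i \<omega>)\<^sup>2))" by (rule ennreal_leI[OF le])
  also have "\<dots> = (\<Sum>i<n. \<integral>\<^sup>+\<omega>. ennreal ((Y i \<omega>)\<^sup>2) \<partial>M)"
    using intY2 by (subst sum_ennreal[symmetric]) (auto simp: nn_integral_eq_integral)
  finally show ?thesis by (simp add: Z_def)
qed

lemma tendsto_zero_of_suminf_finite:
  fixes f :: "nat \<Rightarrow> real"
  assumes "(\<Sum>n. ennreal (f n)) \<noteq> \<infinity>" "\<And>n. 0 \<le> f n"
  shows "f \<longlonglongrightarrow> 0"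
  using assms by (intro summable_LIMSEQ_zero summable_suminf_not_top) auto

lemma suminf_swap_ennreal:
  fixes f :: "nat \<Rightarrow> nat \<Rightarrow> ennreal"
  shows "(\<Sum>i. \<Sum>j. f i j) = (\<Sum>j. \<Sum>i. f i j)"
  using nn_integral_suminf[of "\<lambda>i j. f i j" "count_space UNIV"]
  by (simp add: nn_integral_count_space_nat)

text \<open>The series of squared averages has finite expectation, so it converges almost surely and
  its terms tend to 0. After swapping the sums, each \<open>k\<close> contributes its second moment
  times a tail sum over geometric indices of order \<open>1/(k+1)^2\<close>, which \<open>sq\<close>
  controls.\<close>

lemma (in prob_space) centered_geom_average_tendsto_zero:
  fixes Y :: "nat \<Rightarrow> 'a \<Rightarrow> real"
  assumes indep: "indep_vars (\<lambda>_. borel) Y UNIV"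
    and bdd: "\<And>k \<omega>. \<bar>Y k \<omega>\<bar> \<le> c k"
    and sq: "(\<Sum>k. \<integral>\<^sup>+\<omega>. ennreal ((Y k \<omega> / real (Suc k))\<^sup>2) \<partial>M) < \<infinity>"
    and \<alpha>: "1 < \<alpha>"
  shows "AE \<omega> in M. (\<lambda>n. (\<Sum>k<geom_idx \<alpha> n. Y k \<omega> - expectation (Y k)) / real (geom_idx \<alpha> n)) \<longlonglongrightarrow> 0"
proof -
  have [measurable]: "random_variable borel (Y k)" for k
    using indep by (auto simp: indep_vars_def)
  let ?K = "geom_idx \<alpha>"
  define v where "v k = (\<integral>\<^sup>+\<omega>. ennreal ((Y k \<omega>)\<^sup>2) \<partial>M)" for k
  define D where "D n \<omega> = (\<Sum>k<?K n. Y k \<omega> - expectation (Y k)) / real (?K n)" for n \<omega>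
  define C where "C = 4 / (1 - inverse (\<alpha>\<^sup>2))"
  have "inverse (\<alpha>\<^sup>2) < 1" using \<alpha> by (simp add: inverse_less_1_iff)
  then have C: "0 \<le> C" by (simp add: C_def)
  have [measurable]: "random_variable borel (D n)" for n unfolding D_def by simp
  have v: "(\<integral>\<^sup>+\<omega>. ennreal ((Y k \<omega> / real (Suc k))\<^sup>2) \<partial>M) = v k * ennreal (1 / (real (Suc k))\<^sup>2)" for k
    unfolding v_def
    by (subst nn_integral_multc[symmetric])
      (auto simp: ennreal_mult[symmetric] power_divide simp del: of_nat_Suc intro!: nn_integral_cong)
  have "(\<integral>\<^sup>+\<omega>. ennreal ((D n \<omega>)\<^sup>2) \<partial>M)
      \<le> (\<Sum>k. v k * ennreal (of_bool (k < ?K n) / (real (?K n))\<^sup>2))" for n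
  proof -
    have "(\<integral>\<^sup>+\<omega>. ennreal ((D n \<omega>)\<^sup>2) \<partial>M)
        = (\<integral>\<^sup>+\<omega>. ennreal ((\<Sum>k<?K n. Y k \<omega> - expectation (Y k))\<^sup>2) \<partial>M) * ennreal (1 / (real (?K n))\<^sup>2)"
      by (subst nn_integral_multc[symmetric])
        (auto simp: D_def ennreal_mult[symmetric] power_divide intro!: nn_integral_cong)
    also have "\<dots> \<le> (\<Sum>k<?K n. v k) * ennreal (1 / (real (?K n))\<^sup>2)"
      unfolding v_def by (intro mult_right_mono second_moment_indep_sum_le[OF indep bdd]) auto
    \<comment> \<open>The indicator turns the finite sum into a series over all \<open>k\<close>,
      ready for the swap.\<close>
    also have "\<dots> = (\<Sum>k<?K n. v k * ennreal (of_bool (k < ?K n) / (real (?K n))\<^sup>2))"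
      by (simp add: sum_distrib_right)
    also have "\<dots> \<le> (\<Sum>k. v k * ennreal (of_bool (k < ?K n) / (real (?K n))\<^sup>2))"
      by (intro sum_le_suminf) auto
    finally show ?thesis .
  qed
  then have "(\<integral>\<^sup>+\<omega>. (\<Sum>n. ennreal ((D n \<omega>)\<^sup>2)) \<partial>M)
      \<le> (\<Sum>n. \<Sum>k. v k * ennreal (of_bool (k < ?K n) / (real (?K n))\<^sup>2))"
    by (subst nn_integral_suminf) (auto intro!: suminf_le)
  also have "\<dots> = (\<Sum>k. v k * (\<Sum>n. ennreal (of_bool (k < ?K n) / (real (?K n))\<^sup>2)))"
    by (subst suminf_swap_ennreal) simp
  also have "\<dots> \<le> (\<Sum>k. v k * ennreal (C / (real (Suc k))\<^sup>2))"
    unfolding C_def using geom_idx_tail_sum[OF \<alpha>] by (intro suminf_le mult_left_mono) auto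
  also have "\<dots> = (\<Sum>k. ennreal C * (v k * ennreal (1 / (real (Suc k))\<^sup>2)))"
  proof (intro suminf_cong)
    fix k
    have "ennreal (C / (real (Suc k))\<^sup>2) = ennreal C * ennreal (1 / (real (Suc k))\<^sup>2)"
      using C by (subst ennreal_mult[symmetric]) auto
    then show "v k * ennreal (C / (real (Suc k))\<^sup>2) = ennreal C * (v k * ennreal (1 / (real (Suc k))\<^sup>2))"
      by (simp only: ac_simps)
  qed
  also have "\<dots> = ennreal C * (\<Sum>k. \<integral>\<^sup>+\<omega>. ennreal ((Y k \<omega> / real (Suc k))\<^sup>2) \<partial>M)"
    by (simp only: v ennreal_suminf_cmult)
  also have "\<dots> < \<infinity>" using sq by (simp add: ennreal_mult_less_top)
  finally have "AE \<omega> in M. (\<Sum>n. ennreal ((D n \<omega>)\<^sup>2)) \<noteq> \<infinity>"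
    by (intro nn_integral_PInf_AE) auto
  then show ?thesis
  proof eventually_elim
    case (elim \<omega>)
    then have "(\<lambda>n. (D n \<omega>)\<^sup>2) \<longlonglongrightarrow> 0" by (rule tendsto_zero_of_suminf_finite) simp
    then have "(\<lambda>n. sqrt ((D n \<omega>)\<^sup>2)) \<longlonglongrightarrow> sqrt 0" by (rule tendsto_real_sqrt)
    then have "(\<lambda>n. \<bar>D n \<omega>\<bar>) \<longlonglongrightarrow> 0" by simp
    then show ?case unfolding D_def by (simp only: tendsto_rabs_zero_iff)
  qed
qed

text \<open>\<open>mean\<close> and \<open>tail\<close> stand in for identical distribution;
  \<open>tail\<close> makes the means lost by truncation negligible on average. \<open>sq\<close>
  serves twice: it makes the truncation exact for all large \<open>k\<close>, and it bounds the
  second moments of the truncated variables.\<close>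

theorem (in prob_space) strong_law_nonneg:
  fixes X :: "nat \<Rightarrow> 'a \<Rightarrow> real" and \<delta> :: "nat \<Rightarrow> real"
  assumes indep: "indep_vars (\<lambda>_. borel) X UNIV"
    and nonneg: "\<And>k \<omega>. 0 \<le> X k \<omega>"
    and int: "\<And>k. integrable M (X k)"
    and sq: "(\<Sum>k. \<integral>\<^sup>+\<omega>. ennreal ((min 1 (X k \<omega> / real (Suc k)))\<^sup>2) \<partial>M) < \<infinity>"
    and mean: "(\<lambda>n. (\<Sum>k<n. expectation (X k)) / real n) \<longlonglongrightarrow> m"
    and tail: "\<And>L. (\<lambda>n. (\<Sum>k<n. expectation (\<lambda>\<omega>. X k \<omega> * indicator {real L<..} (X k \<omega>))) / real n)
        \<longlonglongrightarrow> \<delta> L"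
    and \<delta>: "\<delta> \<longlonglongrightarrow> 0"
  shows "AE \<omega> in M. (\<lambda>n. (\<Sum>k<n. X k \<omega>) / real n) \<longlonglongrightarrow> m"
proof -
  have [measurable]: "random_variable borel (X k)" for k
    using indep by (auto simp: indep_vars_def)
  define Y where "Y k \<omega> = X k \<omega> * indicator {..real (Suc k)} (X k \<omega>)" for k \<omega>
  have [measurable]: "random_variable borel (Y k)" for k unfolding Y_def by measurable
  have indepY: "indep_vars (\<lambda>_. borel) Y UNIV"
    unfolding Y_def by (rule indep_vars_compose2[OF indep]) simp
  have bddY: "\<bar>Y k \<omega>\<bar> \<le> real (Suc k)" for k \<omega>
    using nonneg[of k \<omega>] by (auto simp: Y_def indicator_def)
  have Y_le: "\<bar>Y k \<omega> / real (Suc k)\<bar> \<le> min 1 (X k \<omega> / real (Suc k))" for k \<omega>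
    using nonneg[of k \<omega>] by (auto simp: Y_def indicator_def)
  have "(\<Sum>k. \<integral>\<^sup>+\<omega>. ennreal ((Y k \<omega> / real (Suc k))\<^sup>2) \<partial>M)
      \<le> (\<Sum>k. \<integral>\<^sup>+\<omega>. ennreal ((min 1 (X k \<omega> / real (Suc k)))\<^sup>2) \<partial>M)"
    using power_mono[OF Y_le abs_ge_zero, where n = 2]
    by (intro suminf_le nn_integral_mono ennreal_leI) (simp_all only: power2_abs summableI)
  with sq have sqY: "(\<Sum>k. \<integral>\<^sup>+\<omega>. ennreal ((Y k \<omega> / real (Suc k))\<^sup>2) \<partial>M) < \<infinity>"
    by (rule le_less_trans[rotated])
  have intY: "integrable M (Y k)" for k
    by (rule integrable_const_bound[of _ "real (Suc k)"]) (use bddY in auto)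
  define T where "T L k = expectation (\<lambda>\<omega>. X k \<omega> * indicator {real L<..} (X k \<omega>))" for L k
  have int_tail: "integrable M (\<lambda>\<omega>. X k \<omega> * indicator {a<..} (X k \<omega>))" for k a
    by (rule Bochner_Integration.integrable_bound[OF int[of k]]) (auto simp: indicator_def)
  have split: "expectation (X k) = expectation (Y k) + T (Suc k) k" for k
    unfolding T_def
    by (subst Bochner_Integration.integral_add[OF intY int_tail, symmetric])
      (auto simp: Y_def indicator_def intro!: Bochner_Integration.integral_cong)
  have T_nonneg: "0 \<le> T L k" for L k unfolding T_def using nonneg by (simp add: integral_nonneg_AE)
  have T_mono: "T (Suc k) k \<le> T L k" if "L \<le> k" for L k
    unfolding T_def using that nonneg
    by (intro integral_mono int_tail) (auto simp: indicator_def)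
  have "(\<lambda>n. (\<Sum>k<n. T (Suc k) k) / real n) \<longlonglongrightarrow> 0"
    using T_nonneg T_nonneg T_mono tail[folded T_def] \<delta> by (rule average_tendsto_zero_dominated[of "\<lambda>k. T (Suc k) k" T])
  from tendsto_diff[OF mean this]
  have meanY: "(\<lambda>n. (\<Sum>k<n. expectation (Y k)) / real n) \<longlonglongrightarrow> m"
    by (simp add: split sum.distrib add_divide_distrib)
  have "(\<integral>\<^sup>+\<omega>. (\<Sum>k. ennreal ((min 1 (X k \<omega> / real (Suc k)))\<^sup>2)) \<partial>M) < \<infinity>"
    using sq by (subst nn_integral_suminf) auto
  then have "AE \<omega> in M. (\<Sum>k. ennreal ((min 1 (X k \<omega> / real (Suc k)))\<^sup>2)) \<noteq> \<infinity>"
    by (intro nn_integral_PInf_AE) auto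
  moreover have "AE \<omega> in M. \<forall>j. (\<lambda>n. (\<Sum>k<geom_idx (1 + 1 / real (Suc j)) n. Y k \<omega> - expectation (Y k))
      / real (geom_idx (1 + 1 / real (Suc j)) n)) \<longlonglongrightarrow> 0"
    unfolding AE_all_countable
    by (intro allI centered_geom_average_tendsto_zero[OF indepY bddY sqY]) simp
  ultimately show ?thesis
  proof eventually_elim
    case (elim \<omega>)
    have "(\<lambda>k. (min 1 (X k \<omega> / real (Suc k)))\<^sup>2) \<longlonglongrightarrow> 0"
      using elim(1) by (rule tendsto_zero_of_suminf_finite) simp
    then have "\<forall>\<^sub>F k in sequentially. (min 1 (X k \<omega> / real (Suc k)))\<^sup>2 < 1"
      by (rule order_tendstoD) simp
    \<comment> \<open>A minimum below 1 means \<open>X k < k + 1\<close>, where truncation changes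
      nothing.\<close>
    then have "\<forall>\<^sub>F k in sequentially. X k \<omega> - Y k \<omega> = 0"
    proof eventually_elim
      case (elim k)
      then have "min 1 (X k \<omega> / real (Suc k)) < 1"
        by (metis linorder_not_less one_le_power)
      then show ?case by (auto simp: Y_def indicator_def min_def split: if_splits)
    qed
    then obtain N where N: "\<And>k. N \<le> k \<Longrightarrow> X k \<omega> - Y k \<omega> = 0"
      by (auto simp: eventually_sequentially)
    have "\<forall>\<^sub>F n in sequentially. (\<Sum>k<N. X k \<omega> - Y k \<omega>) * inverse (real n)
        = (\<Sum>k<n. X k \<omega> - Y k \<omega>) / real n"
      using eventually_ge_at_top[of N]
    proof eventually_elim
      case (elim n)
      have "(\<Sum>k<n. X k \<omega> - Y k \<omega>) = (\<Sum>k<N. X k \<omega> - Y k \<omega>)"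
        using elim N by (intro sum.mono_neutral_right) auto
      then show ?case by (simp add: divide_inverse)
    qed
    moreover have "(\<lambda>n. (\<Sum>k<N. X k \<omega> - Y k \<omega>) * inverse (real n)) \<longlonglongrightarrow> (\<Sum>k<N. X k \<omega> - Y k \<omega>) * 0"
      by (intro tendsto_intros lim_inverse_n)
    ultimately have XY: "(\<lambda>n. (\<Sum>k<n. X k \<omega> - Y k \<omega>) / real n) \<longlonglongrightarrow> 0"
      using Lim_transform_eventually by fastforce
    \<comment> \<open>The average of \<open>X\<close> splits into those of \<open>X - Y\<close>, of
      the means of \<open>Y\<close> and of the centered \<open>Y\<close>. The last one is controlled
      only along geometric indices, which is enough since the partial sums of \<open>X\<close>
      increase.\<close>
    have XYm: "(\<lambda>n. (\<Sum>k<n. X k \<omega> - Y k \<omega>) / real n + (\<Sum>k<n. expectation (Y k)) / real n) \<longlonglongrightarrow> 0 + m"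
      by (intro tendsto_add XY meanY)
    show ?case
    proof (rule average_tendsto_of_geom_idx)
      fix j
      let ?K = "geom_idx (1 + 1 / real (Suc j))"
      have "filterlim ?K sequentially sequentially" by (rule geom_idx_at_top) simp
      from tendsto_add[OF filterlim_compose[OF XYm this] spec[OF elim(2), of j]]
      show "(\<lambda>n. (\<Sum>k<?K n. X k \<omega>) / real (?K n)) \<longlonglongrightarrow> m"
        by (simp add: add_divide_distrib[symmetric] sum.distrib[symmetric] del: of_nat_Suc)
    qed (auto intro!: incseq_SucI sum_nonneg nonneg)
  qed
qed

section \<open>Laws of large numbers for the coordinates of a product measure\<close>

lemma nn_integral_PiM_component:
  assumes "\<And>i. prob_space (M i)" "g \<in> borel_measurable (M k)"
  shows "(\<integral>\<^sup>+\<omega>. g (\<omega> k) \<partial>PiM UNIV M) = (\<integral>\<^sup>+x. g x \<partial>M k)"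
  using nn_integral_distr[of "\<lambda>\<omega>. \<omega> k" "PiM UNIV M" "M k" g] distr_PiM_component[of UNIV M k] assms
  by simp

lemma indep_vars_PiM_component:
  assumes "\<And>i. prob_space (M i)"
  shows "prob_space.indep_vars (PiM UNIV M) M (\<lambda>i \<omega>. \<omega> i) UNIV"
proof -
  interpret P: prob_space "PiM UNIV M" using assms by (rule prob_space_PiM)
  have "distr (PiM UNIV M) (PiM UNIV M) (\<lambda>x. \<lambda>i\<in>UNIV. x i) = PiM UNIV M"
    by (simp add: restrict_UNIV distr_id)
  then show ?thesis
    by (subst P.indep_vars_iff_distr_eq_PiM) (simp_all add: distr_PiM_component assms)
qed

text \<open>Independence is built into the product, so all hypotheses concern the marginals. These
  may differ from each other, as they do in the quenched law of the \<open>\<zeta>\<close>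
  variables.\<close>

theorem strong_law_PiM:
  fixes X :: "nat \<Rightarrow> 'a \<Rightarrow> real"
  assumes M: "\<And>k. prob_space (M k)"
    and meas: "\<And>k. X k \<in> borel_measurable (M k)"
    and nonneg: "\<And>k x. 0 \<le> X k x"
    and fin: "\<And>k. (\<integral>\<^sup>+x. ennreal (X k x) \<partial>M k) < \<infinity>"
    and sq: "(\<Sum>k. \<integral>\<^sup>+x. ennreal ((min 1 (X k x / real (Suc k)))\<^sup>2) \<partial>M k) < \<infinity>"
    and mean: "(\<lambda>n. (\<Sum>k<n. enn2real (\<integral>\<^sup>+x. ennreal (X k x) \<partial>M k)) / real n) \<longlonglongrightarrow> m"
    and tail: "\<And>L. (\<lambda>n. (\<Sum>k<n. enn2real (\<integral>\<^sup>+x. ennreal (X k x * indicator {real L<..} (X k x)) \<partial>M k)) / real n)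
        \<longlonglongrightarrow> \<delta> L"
    and \<delta>: "\<delta> \<longlonglongrightarrow> 0"
  shows "AE \<omega> in PiM UNIV M. (\<lambda>n. (\<Sum>k<n. X k (\<omega> k)) / real n) \<longlonglongrightarrow> m"
proof -
  note [measurable] = meas
  interpret P: prob_space "PiM UNIV M" using M by (rule prob_space_PiM)
  have nn: "(\<integral>\<^sup>+\<omega>. g (\<omega> k) \<partial>PiM UNIV M) = (\<integral>\<^sup>+x. g x \<partial>M k)"
    if "g \<in> borel_measurable (M k)" for g k
    using nn_integral_PiM_component[of M g k] M that by blast
  have exp: "P.expectation (\<lambda>\<omega>. g (\<omega> k)) = enn2real (\<integral>\<^sup>+x. ennreal (g x) \<partial>M k)"
    if "g \<in> borel_measurable (M k)" "\<And>x. 0 \<le> g x" for g k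
    using that by (subst integral_eq_nn_integral) (auto simp: nn[of "\<lambda>x. ennreal (g x)"])
  show ?thesis
  proof (rule P.strong_law_nonneg[where X = "\<lambda>k \<omega>. X k (\<omega> k)" and \<delta> = \<delta>])
    show "P.indep_vars (\<lambda>_. borel) (\<lambda>k \<omega>. X k (\<omega> k)) UNIV"
      by (rule P.indep_vars_compose2[OF indep_vars_PiM_component[OF M]]) simp
    show "integrable (PiM UNIV M) (\<lambda>\<omega>. X k (\<omega> k))" for k
      using fin nonneg by (intro integrableI_nonneg) (auto simp: nn[of "\<lambda>x. ennreal (X k x)" k])
    show "(\<Sum>k. \<integral>\<^sup>+\<omega>. ennreal ((min 1 (X k (\<omega> k) / real (Suc k)))\<^sup>2) \<partial>PiM UNIV M) < \<infinity>"
      using sq by (subst nn[of "\<lambda>x. ennreal ((min 1 (X _ x / real (Suc _)))\<^sup>2)"]) auto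
    show "(\<lambda>n. (\<Sum>k<n. P.expectation (\<lambda>\<omega>. X k (\<omega> k))) / real n) \<longlonglongrightarrow> m"
      using mean by (subst exp) (auto simp: nonneg)
    show "(\<lambda>n. (\<Sum>k<n. P.expectation (\<lambda>\<omega>. X k (\<omega> k) * indicator {real L<..} (X k (\<omega> k)))) / real n)
        \<longlonglongrightarrow> \<delta> L" for L
      using tail[of L] by (subst exp[of "\<lambda>x. X _ x * indicator {real L<..} (X _ x)"]) (auto simp: nonneg)
  qed (use nonneg \<delta> in auto)
qed

lemma suminf_min_square_le:
  assumes "0 \<le> (x::real)"
  shows "(\<Sum>k. ennreal ((min 1 (x / real (Suc k)))\<^sup>2)) \<le> 4 * ennreal x"
proof -
  have "(\<Sum>k. ennreal ((min 1 (x / real (Suc k)))\<^sup>2)) \<le> ennreal (4 * x)"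
    using sum_min_square_le[OF assms]
    by (intro suminf_le_const) (auto simp: sum_ennreal intro!: ennreal_leI)
  then show ?thesis using assms by (simp add: ennreal_mult)
qed

lemma average_const_tendsto: "(\<lambda>n. (\<Sum>k<n. c) / real n) \<longlonglongrightarrow> (c::real)"
  by (rule Lim_transform_eventually[OF tendsto_const])
    (use eventually_gt_at_top[of 0] in eventually_elim, simp)

text \<open>Integrating the pointwise bound \<open>4 * x\<close> on the series reduces
  \<open>sq\<close> to integrability, while means and tails do not depend on the index. The function
  is extended-valued because means and variances are, hence the almost sure finiteness in the
  conclusion.\<close>

theorem strong_law_iid:
  fixes f :: "'a \<Rightarrow> ennreal"
  assumes M: "prob_space M" and meas [measurable]: "f \<in> borel_measurable M"
    and fin: "(\<integral>\<^sup>+x. f x \<partial>M) < \<infinity>"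
  shows "AE \<omega> in PiM UNIV (\<lambda>_::nat. M). (\<forall>k. f (\<omega> k) < \<infinity>) \<and>
    (\<lambda>n. (\<Sum>k<n. enn2real (f (\<omega> k))) / real n) \<longlonglongrightarrow> enn2real (\<integral>\<^sup>+x. f x \<partial>M)"
proof -
  define X where "X x = enn2real (f x)" for x
  have [measurable]: "X \<in> borel_measurable M" unfolding X_def by measurable
  have X0: "0 \<le> X x" for x by (simp add: X_def)
  have AEfin: "AE x in M. f x < \<infinity>"
    using nn_integral_PInf_AE[OF meas] fin by (auto simp: less_top)
  have Xf: "(\<integral>\<^sup>+x. ennreal (X x) \<partial>M) = (\<integral>\<^sup>+x. f x \<partial>M)"
    by (rule nn_integral_cong_AE) (use AEfin in eventually_elim, simp add: X_def)
  have "(\<Sum>k. \<integral>\<^sup>+x. ennreal ((min 1 (X x / real (Suc k)))\<^sup>2) \<partial>M)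
      = (\<integral>\<^sup>+x. (\<Sum>k. ennreal ((min 1 (X x / real (Suc k)))\<^sup>2)) \<partial>M)"
    by (subst nn_integral_suminf) auto
  also have "\<dots> \<le> (\<integral>\<^sup>+x. 4 * ennreal (X x) \<partial>M)"
    by (intro nn_integral_mono suminf_min_square_le X0)
  also have "\<dots> = 4 * (\<integral>\<^sup>+x. f x \<partial>M)" by (simp add: nn_integral_cmult Xf)
  also have "\<dots> < \<infinity>" using fin by (simp add: ennreal_mult_less_top)
  finally have sq: "(\<Sum>k. \<integral>\<^sup>+x. ennreal ((min 1 (X x / real (Suc k)))\<^sup>2) \<partial>M) < \<infinity>" .
  define t where "t L x = ennreal (X x * indicator {real L<..} (X x))" for L :: nat and x
  have [measurable]: "t L \<in> borel_measurable M" for L unfolding t_def by measurable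
  have "(\<lambda>L. \<integral>\<^sup>+x. t L x \<partial>M) \<longlonglongrightarrow> (\<integral>\<^sup>+x. 0 \<partial>M)"
  proof (rule nn_integral_dominated_convergence[where w = "\<lambda>x. ennreal (X x)"])
    show "AE x in M. (\<lambda>L. t L x) \<longlonglongrightarrow> 0"
    proof (intro AE_I2 tendsto_eventually)
      fix x
      obtain N :: nat where N: "X x \<le> real N" using real_arch_simple by blast
      show "\<forall>\<^sub>F L in sequentially. t L x = 0"
        using eventually_ge_at_top[of N]
        by eventually_elim (use N in \<open>auto simp: t_def indicator_def\<close>)
    qed
  qed (use fin X0 in \<open>auto simp: t_def Xf indicator_def intro!: ennreal_leI\<close>)
  then have \<delta>: "(\<lambda>L. enn2real (\<integral>\<^sup>+x. t L x \<partial>M)) \<longlonglongrightarrow> 0"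
    by (intro tendsto_enn2real) simp_all
  have "AE \<omega> in PiM UNIV (\<lambda>_::nat. M). (\<lambda>n. (\<Sum>k<n. X (\<omega> k)) / real n) \<longlonglongrightarrow> enn2real (\<integral>\<^sup>+x. f x \<partial>M)"
    using M X0 sq \<delta> fin
    by (intro strong_law_PiM[where \<delta> = "\<lambda>L. enn2real (\<integral>\<^sup>+x. t L x \<partial>M)"])
      (auto simp: Xf t_def[symmetric] simp del: sum_constant intro: average_const_tendsto)
  moreover have "AE \<omega> in PiM UNIV (\<lambda>_::nat. M). \<forall>k. f (\<omega> k) < \<infinity>"
    unfolding AE_all_countable using M AEfin by (auto intro: AE_PiM_component)
  ultimately show ?thesis unfolding X_def by eventually_elim simp
qed

section \<open>Random probability measures on the natural numbers\<close>

text \<open>Half the second factorial moment. For mean 1 it is half the variance, the mean of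
  \<open>zeta_law \<nu>\<close>, and the limit of \<open>gen_fun_curv \<nu> s\<close> as
  \<open>s\<close> increases to 1.\<close>

definition binom_moment :: "nat measure \<Rightarrow> ennreal" where
  "binom_moment \<nu> = (\<integral>\<^sup>+i. of_nat (i choose 2) \<partial>\<nu>)"

lemma measurable_nat_measure:
  "sets \<nu> = sets (count_space (UNIV :: nat set)) \<Longrightarrow> (f :: nat \<Rightarrow> 'b::topological_space) \<in> borel_measurable \<nu>"
  by (subst measurable_cong_sets[of \<nu> "count_space UNIV" borel borel]) auto

lemma in_space_prob_measures_nat:
  assumes "\<nu> \<in> space prob_measures_nat"
  shows "prob_space \<nu>" "sets \<nu> = sets (count_space UNIV)"
  using assms by (auto simp: space_prob_algebra)

lemma nn_integral_measurable_prob_measures_nat: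
  assumes "sets \<Lambda> = sets prob_measures_nat"
  shows "(\<lambda>\<nu>. \<integral>\<^sup>+i. g i \<partial>\<nu>) \<in> borel_measurable \<Lambda>"
proof -
  have "(\<lambda>\<nu>. \<integral>\<^sup>+i. g i \<partial>\<nu>) \<in> borel_measurable prob_measures_nat"
    unfolding prob_algebra_def
    by (intro measurable_restrict_space1 nn_integral_measurable_subprob_algebra) simp
  then show ?thesis using assms by (simp cong: measurable_cong_sets)
qed

lemma binom_moment_measurable:
  "sets \<Lambda> = sets prob_measures_nat \<Longrightarrow> binom_moment \<in> borel_measurable \<Lambda>"
  unfolding binom_moment_def by (rule nn_integral_measurable_prob_measures_nat)

lemma second_moment_eq:
  assumes "\<nu> \<in> space prob_measures_nat" "mean \<nu> = 1"
  shows "(\<integral>\<^sup>+i. of_nat (i\<^sup>2) \<partial>\<nu>) = 2 * binom_moment \<nu> + 1"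
proof -
  note \<nu> = in_space_prob_measures_nat[OF assms(1)]
  note [measurable] = measurable_nat_measure[OF \<nu>(2)]
  have "2 * binom_moment \<nu> + 1 = (\<integral>\<^sup>+i. 2 * of_nat (i choose 2) + of_nat i \<partial>\<nu>)"
    using assms(2) by (simp add: binom_moment_def mean_def nn_integral_add nn_integral_cmult)
  also have "\<dots> = (\<integral>\<^sup>+i. of_nat (i\<^sup>2) \<partial>\<nu>)"
  proof (intro nn_integral_cong)
    fix i :: nat
    have "2 * (i choose 2) + i = i\<^sup>2"
      by (cases i) (simp_all add: choose_two power2_eq_square)
    then show "2 * of_nat (i choose 2) + of_nat i = (of_nat (i\<^sup>2) :: ennreal)"
      by (metis of_nat_add of_nat_mult of_nat_numeral)
  qed
  finally show ?thesis by simp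
qed

text \<open>Integrating \<open>(i - 1)^2 + 2 * i = i^2 + 1\<close> avoids subtraction of moments, so
  the identity covers infinite variances as well.\<close>

lemma var_eq_binom_moment:
  assumes "\<nu> \<in> space prob_measures_nat" "mean \<nu> = 1"
  shows "var \<nu> = 2 * binom_moment \<nu>"
proof -
  note \<nu> = in_space_prob_measures_nat[OF assms(1)]
  interpret prob_space \<nu> by (rule \<nu>(1))
  note [measurable] = measurable_nat_measure[OF \<nu>(2)]
  have "var \<nu> + 2 = (\<integral>\<^sup>+i. ennreal ((real i - 1)\<^sup>2) + 2 * of_nat i \<partial>\<nu>)"
    using assms(2) by (simp add: var_def mean_def nn_integral_add nn_integral_cmult)
  also have "\<dots> = (\<integral>\<^sup>+i. of_nat (i\<^sup>2) + 1 \<partial>\<nu>)"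
  proof (intro nn_integral_cong)
    fix i :: nat
    have "ennreal ((real i - 1)\<^sup>2) + 2 * of_nat i = ennreal ((real i - 1)\<^sup>2 + 2 * real i)"
      by (simp add: ennreal_plus ennreal_mult ennreal_of_nat_eq_real_of_nat)
    also have "(real i - 1)\<^sup>2 + 2 * real i = real (i\<^sup>2) + 1"
      by (simp add: power2_eq_square algebra_simps)
    also have "ennreal \<dots> = of_nat (i\<^sup>2) + 1"
      by (simp add: ennreal_plus ennreal_of_nat_eq_real_of_nat del: of_nat_power)
    finally show "ennreal ((real i - 1)\<^sup>2) + 2 * of_nat i = of_nat (i\<^sup>2) + 1" .
  qed
  also have "\<dots> = 2 * binom_moment \<nu> + 2"
    using second_moment_eq[OF assms]
    by (simp add: nn_integral_add emeasure_space_1 add.assoc del: of_nat_power)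
  finally show ?thesis by simp
qed

section \<open>Size-biasing and the law of the \<open>\<zeta>\<close> variables\<close>

lemma prob_space_size_biased:
  assumes "\<nu> \<in> space prob_measures_nat" "mean \<nu> = 1"
  shows "prob_space (size_biased \<nu>)"
proof -
  note \<nu> = in_space_prob_measures_nat[OF assms(1)]
  note [measurable] = measurable_nat_measure[OF \<nu>(2)]
  have "emeasure (size_biased \<nu>) (space (size_biased \<nu>)) = (\<integral>\<^sup>+i. of_nat i * indicator (space \<nu>) i \<partial>\<nu>)"
    unfolding size_biased_def by (simp add: emeasure_density)
  also have "\<dots> = mean \<nu>" unfolding mean_def by (intro nn_integral_cong) simp
  finally show ?thesis using assms(2) by (intro prob_spaceI) simp
qed

text \<open>The size-bias weight \<open>i\<close> cancels the uniform weight \<open>1/i\<close>,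
  which leaves plain sums over \<open>{..<i}\<close>. With \<open>h\<close> the identity, the mean
  of \<open>\<zeta>\<close> comes out as \<open>binom_moment \<nu>\<close>.\<close>

lemma
  assumes "\<nu> \<in> space prob_measures_nat" "mean \<nu> = 1"
  shows sets_zeta_law: "sets (zeta_law \<nu>) = sets (count_space UNIV)"
    and prob_space_zeta_law: "prob_space (zeta_law \<nu>)"
    and nn_integral_zeta_law: "(\<integral>\<^sup>+z. h z \<partial>zeta_law \<nu>) = (\<integral>\<^sup>+i. (\<Sum>z<i. h z) \<partial>\<nu>)"
proof -
  note \<nu> = in_space_prob_measures_nat[OF assms(1)]
  note [measurable] = measurable_nat_measure[OF \<nu>(2)]
  interpret B: prob_space "size_biased \<nu>" by (rule prob_space_size_biased[OF assms])
  have sB: "sets (size_biased \<nu>) = sets (count_space UNIV)" using \<nu>(2) by (simp add: size_biased_def)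
  have K: "(\<lambda>i. measure_pmf (pmf_of_set {..<i})) \<in> measurable (size_biased \<nu>) (subprob_algebra (count_space UNIV))"
    by (subst measurable_cong_sets[OF sB refl]) (auto intro: measure_pmf_in_subprob_space)
  show "sets (zeta_law \<nu>) = sets (count_space UNIV)"
    unfolding zeta_law_def by (rule sets_bind) (auto simp: B.not_empty)
  show "prob_space (zeta_law \<nu>)"
    unfolding zeta_law_def by (rule B.prob_space_bind[OF _ K]) (auto simp: prob_space_measure_pmf)
  have "(\<integral>\<^sup>+z. h z \<partial>zeta_law \<nu>) = (\<integral>\<^sup>+i. of_nat i * (\<integral>\<^sup>+z. h z \<partial>measure_pmf (pmf_of_set {..<i})) \<partial>\<nu>)"
    unfolding zeta_law_def by (subst nn_integral_bind[OF _ K]) (auto simp: size_biased_def nn_integral_density)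
  also have "\<dots> = (\<integral>\<^sup>+i. (\<Sum>z<i. h z) \<partial>\<nu>)"
  proof (intro nn_integral_cong)
    fix i :: nat
    show "of_nat i * (\<integral>\<^sup>+z. h z \<partial>measure_pmf (pmf_of_set {..<i})) = (\<Sum>z<i. h z)"
    \<comment> \<open>At \<open>i = 0\<close> the unspecified \<open>pmf_of_set {}\<close> is
      multiplied by 0, and the sum is empty.\<close>
    proof (cases "i = 0")
      case False
      then have "of_nat i * (\<integral>\<^sup>+z. h z \<partial>measure_pmf (pmf_of_set {..<i})) = of_nat i * ((\<Sum>z<i. h z) / of_nat i)"
        by (subst nn_integral_pmf_of_set) auto
      also have "\<dots> = (\<Sum>z<i. h z)"
        using False by (subst ennreal_times_divide, subst mult.commute, intro ennreal_mult_divide_eq) auto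
      finally show ?thesis .
    qed simp
  qed
  finally show "(\<integral>\<^sup>+z. h z \<partial>zeta_law \<nu>) = (\<integral>\<^sup>+i. (\<Sum>z<i. h z) \<partial>\<nu>)" .
qed

lemma sum_nat_lessThan: "(\<Sum>z<i. z) = i choose 2"
  by (induction i) (simp_all add: numeral_2_eq_2)

text \<open>Dominated convergence twice: under almost every \<open>\<nu>\<close> with dominating
  function \<open>G\<close>, and then under \<open>\<Lambda>\<close> with the integral of
  \<open>G\<close>.\<close>

lemma nn_integral_annealed_tendsto_zero:
  fixes g :: "nat \<Rightarrow> nat \<Rightarrow> ennreal"
  assumes \<Lambda>: "sets \<Lambda> = sets prob_measures_nat"
    and le: "\<And>L i. g L i \<le> G i"
    and fin: "(\<integral>\<^sup>+\<nu>. \<integral>\<^sup>+i. G i \<partial>\<nu> \<partial>\<Lambda>) < \<infinity>"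
    and lim: "\<And>i. (\<lambda>L. g L i) \<longlonglongrightarrow> 0"
  shows "(\<lambda>L. \<integral>\<^sup>+\<nu>. \<integral>\<^sup>+i. g L i \<partial>\<nu> \<partial>\<Lambda>) \<longlonglongrightarrow> 0"
proof -
  note [measurable] = nn_integral_measurable_prob_measures_nat[OF \<Lambda>]
  have "(\<lambda>L. \<integral>\<^sup>+\<nu>. \<integral>\<^sup>+i. g L i \<partial>\<nu> \<partial>\<Lambda>) \<longlonglongrightarrow> (\<integral>\<^sup>+\<nu>. 0 \<partial>\<Lambda>)"
  proof (rule nn_integral_dominated_convergence[where w = "\<lambda>\<nu>. \<integral>\<^sup>+i. G i \<partial>\<nu>"])
    have "AE \<nu> in \<Lambda>. (\<integral>\<^sup>+i. G i \<partial>\<nu>) \<noteq> \<infinity>" using fin by (intro nn_integral_PInf_AE) auto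
    moreover have "AE \<nu> in \<Lambda>. \<nu> \<in> space prob_measures_nat"
      using AE_space[of \<Lambda>] sets_eq_imp_space_eq[OF \<Lambda>] by simp
    ultimately show "AE \<nu> in \<Lambda>. (\<lambda>L. \<integral>\<^sup>+i. g L i \<partial>\<nu>) \<longlonglongrightarrow> 0"
    proof eventually_elim
      case (elim \<nu>)
      note [measurable] = measurable_nat_measure[OF in_space_prob_measures_nat(2)[OF elim(2)]]
      have "(\<lambda>L. \<integral>\<^sup>+i. g L i \<partial>\<nu>) \<longlonglongrightarrow> (\<integral>\<^sup>+i. 0 \<partial>\<nu>)"
        using elim(1) le lim
        by (intro nn_integral_dominated_convergence[where w = G]) (auto simp: less_top)
      then show ?case by simp
    qed
  qed (use fin le in \<open>auto intro!: nn_integral_mono\<close>)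
  then show ?thesis by simp
qed

text \<open>In a fixed environment the \<open>\<zeta>\<close> variables are independent with
  different laws, so \<open>strong_law_PiM\<close> is applied environment by environment. The
  averages of quenched means and tails converge by \<open>strong_law_iid\<close>, since they are
  functions of a single law; the series of truncated second moments is finite in almost every
  environment because its expectation over environments is.\<close>

theorem quenched_zeta_strong_law:
  assumes \<Lambda>: "prob_space \<Lambda>" "sets \<Lambda> = sets prob_measures_nat"
    and mean1: "AE \<nu> in \<Lambda>. mean \<nu> = 1"
    and fin: "(\<integral>\<^sup>+\<nu>. binom_moment \<nu> \<partial>\<Lambda>) < \<infinity>"
  shows "AE \<mu> in environment_law \<Lambda>. AE \<zeta> in quenched_zeta_law \<mu>.
    (\<lambda>n. (\<Sum>k<n. real (\<zeta> k)) / real n) \<longlonglongrightarrow> enn2real (\<integral>\<^sup>+\<nu>. binom_moment \<nu> \<partial>\<Lambda>)"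
proof -
  note [measurable] = nn_integral_measurable_prob_measures_nat[OF \<Lambda>(2)]
  define m where "m = enn2real (\<integral>\<^sup>+\<nu>. binom_moment \<nu> \<partial>\<Lambda>)"
  \<comment> \<open>Integrated against \<open>\<nu>\<close>, \<open>t L\<close> gives the
    contribution of the values above \<open>L\<close> to the mean of
    \<open>zeta_law \<nu>\<close>.\<close>
  define t where "t L i = (\<Sum>z<i. z * of_bool (L < z))" for L i :: nat
  have t_le: "t L i \<le> i choose 2" for L i
    unfolding t_def sum_nat_lessThan[symmetric] by (intro sum_mono) auto
  define T where "T L \<nu> = (\<integral>\<^sup>+i. of_nat (t L i) \<partial>\<nu>)" for L and \<nu> :: "nat measure"
  note [measurable] = binom_moment_measurable[OF \<Lambda>(2)]
  have [measurable]: "T L \<in> borel_measurable \<Lambda>" for L unfolding T_def by measurable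
  have space: "AE \<mu> in environment_law \<Lambda>. \<forall>k. \<mu> k \<in> space prob_measures_nat"
    using sets_eq_imp_space_eq[OF \<Lambda>(2)] unfolding environment_law_def
    by (intro AE_I2) (auto simp: space_PiM)
  have mean1': "AE \<mu> in environment_law \<Lambda>. \<forall>k. mean (\<mu> k) = 1"
    unfolding AE_all_countable environment_law_def using \<Lambda>(1) mean1 by (auto intro: AE_PiM_component)
  have T_fin: "(\<integral>\<^sup>+\<nu>. T L \<nu> \<partial>\<Lambda>) < \<infinity>" for L
    using fin unfolding T_def binom_moment_def
    by (rule le_less_trans[rotated]) (intro nn_integral_mono of_nat_mono t_le)
  have slln: "AE \<mu> in environment_law \<Lambda>. (\<forall>k. binom_moment (\<mu> k) < \<infinity>) \<and>
      (\<lambda>n. (\<Sum>k<n. enn2real (binom_moment (\<mu> k))) / real n) \<longlonglongrightarrow> m"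
    unfolding m_def environment_law_def by (intro strong_law_iid \<Lambda> fin) simp
  have slln_t: "AE \<mu> in environment_law \<Lambda>. \<forall>L. (\<forall>k. T L (\<mu> k) < \<infinity>) \<and>
      (\<lambda>n. (\<Sum>k<n. enn2real (T L (\<mu> k))) / real n) \<longlonglongrightarrow> enn2real (\<integral>\<^sup>+\<nu>. T L \<nu> \<partial>\<Lambda>)"
    unfolding AE_all_countable environment_law_def by (intro allI strong_law_iid \<Lambda> T_fin) simp
  have "(\<lambda>L. \<integral>\<^sup>+\<nu>. T L \<nu> \<partial>\<Lambda>) \<longlonglongrightarrow> 0"
    unfolding T_def
  proof (rule nn_integral_annealed_tendsto_zero[OF \<Lambda>(2)])
    show "of_nat (t L i) \<le> (of_nat (i choose 2) :: ennreal)" for L i by (intro of_nat_mono t_le)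
    show "(\<lambda>L. of_nat (t L i) :: ennreal) \<longlonglongrightarrow> 0" for i
      by (rule tendsto_eventually)
        (use eventually_ge_at_top[of i] in eventually_elim, auto simp: t_def indicator_def)
  qed (use fin in \<open>simp add: binom_moment_def\<close>)
  then have \<delta>: "(\<lambda>L. enn2real (\<integral>\<^sup>+\<nu>. T L \<nu> \<partial>\<Lambda>)) \<longlonglongrightarrow> 0"
    by (intro tendsto_enn2real) simp_all
  define w where "w k z = ennreal ((min 1 (real z / real (Suc k)))\<^sup>2)" for k z
  have "(\<integral>\<^sup>+\<mu>. (\<Sum>k. \<integral>\<^sup>+i. (\<Sum>z<i. w k z) \<partial>\<mu> k) \<partial>environment_law \<Lambda>)
      = (\<Sum>k. \<integral>\<^sup>+\<nu>. \<integral>\<^sup>+i. (\<Sum>z<i. w k z) \<partial>\<nu> \<partial>\<Lambda>)"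
    unfolding environment_law_def
    using \<Lambda>(1) by (subst nn_integral_suminf) (auto simp: nn_integral_PiM_component[of "\<lambda>_. \<Lambda>" "\<lambda>\<nu>. \<integral>\<^sup>+i. (\<Sum>z<i. w k z) \<partial>\<nu>" k for k])
  also have "\<dots> = (\<integral>\<^sup>+\<nu>. (\<Sum>k. \<integral>\<^sup>+i. (\<Sum>z<i. w k z) \<partial>\<nu>) \<partial>\<Lambda>)"
    by (subst nn_integral_suminf) auto
  also have "\<dots> \<le> (\<integral>\<^sup>+\<nu>. 4 * binom_moment \<nu> \<partial>\<Lambda>)"
  proof (intro nn_integral_mono)
    fix \<nu> assume "\<nu> \<in> space \<Lambda>"
    then have "\<nu> \<in> space prob_measures_nat" using sets_eq_imp_space_eq[OF \<Lambda>(2)] by simp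
    note [measurable] = measurable_nat_measure[OF in_space_prob_measures_nat(2)[OF this]]
    have "(\<Sum>k. \<integral>\<^sup>+i. (\<Sum>z<i. w k z) \<partial>\<nu>) = (\<integral>\<^sup>+i. (\<Sum>k. \<Sum>z<i. w k z) \<partial>\<nu>)"
      by (subst nn_integral_suminf) auto
    also have "\<dots> = (\<integral>\<^sup>+i. (\<Sum>z<i. \<Sum>k. w k z) \<partial>\<nu>)"
      by (intro nn_integral_cong suminf_sum) auto
    also have "\<dots> \<le> (\<integral>\<^sup>+i. (\<Sum>z<i. 4 * of_nat z) \<partial>\<nu>)"
      unfolding w_def ennreal_of_nat_eq_real_of_nat
      by (intro nn_integral_mono sum_mono suminf_min_square_le) simp
    also have "\<dots> = 4 * binom_moment \<nu>"
      unfolding binom_moment_def sum_nat_lessThan[symmetric]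
      by (simp add: nn_integral_cmult[symmetric] sum_distrib_left)
    finally show "(\<Sum>k. \<integral>\<^sup>+i. (\<Sum>z<i. w k z) \<partial>\<nu>) \<le> 4 * binom_moment \<nu>" .
  qed
  also have "\<dots> < \<infinity>" using fin by (simp add: nn_integral_cmult ennreal_mult_less_top)
  finally have "AE \<mu> in environment_law \<Lambda>. (\<Sum>k. \<integral>\<^sup>+i. (\<Sum>z<i. w k z) \<partial>\<mu> k) \<noteq> \<infinity>"
    unfolding environment_law_def by (intro nn_integral_PInf_AE) auto
  with space mean1' slln slln_t show ?thesis
    unfolding m_def[symmetric]
  proof eventually_elim
    case (elim \<mu>)
    have Z: "\<mu> k \<in> space prob_measures_nat" "mean (\<mu> k) = 1" for k using elim by auto
    note int = nn_integral_zeta_law[OF Z]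
    have meas: "(f :: nat \<Rightarrow> real) \<in> borel_measurable (zeta_law (\<mu> k))" for f k
      by (rule measurable_nat_measure[OF sets_zeta_law[OF Z]])
    have id: "(\<integral>\<^sup>+z. ennreal (real z) \<partial>zeta_law (\<mu> k)) = binom_moment (\<mu> k)" for k
      by (simp add: int binom_moment_def sum_nat_lessThan[symmetric] ennreal_of_nat_eq_real_of_nat sum_ennreal)
    have tl: "(\<integral>\<^sup>+z. ennreal (real z * indicator {real L<..} (real z)) \<partial>zeta_law (\<mu> k)) = T L (\<mu> k)" for k L
      by (auto simp add: int T_def t_def ennreal_of_nat_eq_real_of_nat sum_ennreal indicator_def intro!: nn_integral_cong sum.cong)
    show ?case
      unfolding quenched_zeta_law_def
      by (rule strong_law_PiM[where \<delta> = "\<lambda>L. enn2real (\<integral>\<^sup>+\<nu>. T L \<nu> \<partial>\<Lambda>)"])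
        (use elim \<delta> prob_space_zeta_law[OF Z] meas in
          \<open>auto simp: id tl int w_def[symmetric] less_top simp del: of_nat_Suc\<close>)
  qed
qed

section \<open>The shape function\<close>

text \<open>For mean 1 these are the difference quotients \<open>(1 - gen_fun \<nu> s) / (1 - s)\<close> and
  \<open>(gen_fun \<nu> s - s) / (1 - s)\<^sup>2\<close>, written as expectations of polynomials with nonnegative
  coefficients, so that monotonicity in \<open>s\<close> is evident.\<close>

definition gen_fun_slope :: "nat measure \<Rightarrow> real \<Rightarrow> ennreal" where
  "gen_fun_slope \<nu> s = (\<integral>\<^sup>+i. ennreal (\<Sum>j<i. s ^ j) \<partial>\<nu>)"

definition gen_fun_curv :: "nat measure \<Rightarrow> real \<Rightarrow> ennreal" where
  "gen_fun_curv \<nu> s = (\<integral>\<^sup>+i. ennreal (\<Sum>j<i. \<Sum>l<j. s ^ l) \<partial>\<nu>)"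

text \<open>The power series becomes an expectation, to which monotonicity and linearity apply.
  Nonnegativity is recorded separately because \<open>ennreal\<close> forgets negative
  values.\<close>

lemma nn_integral_power_eq_gen_fun:
  assumes \<nu>: "\<nu> \<in> space prob_measures_nat" and s: "0 \<le> s" "s \<le> 1"
  shows "(\<integral>\<^sup>+i. ennreal (s ^ i) \<partial>\<nu>) = ennreal (gen_fun \<nu> s)" "0 \<le> gen_fun \<nu> s"
proof -
  note \<nu>' = in_space_prob_measures_nat[OF \<nu>]
  interpret prob_space \<nu> by (rule \<nu>'(1))
  note [measurable] = measurable_nat_measure[OF \<nu>'(2)]
  have [simp]: "A \<in> sets \<nu>" for A using \<nu>'(2) by simp
  have ind: "(\<Sum>j. ennreal (s ^ j) * indicator {j} i) = ennreal (s ^ i)" for i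
    using suminf_finite[of "{i}" "\<lambda>j. ennreal (s ^ j) * indicator {j} i"] by (auto simp: indicator_def)
  have "(\<integral>\<^sup>+i. ennreal (s ^ i) \<partial>\<nu>) = (\<integral>\<^sup>+i. (\<Sum>j. ennreal (s ^ j) * indicator {j} i) \<partial>\<nu>)"
    by (simp only: ind)
  also have "\<dots> = (\<Sum>j. ennreal (s ^ j) * emeasure \<nu> {j})"
    by (subst nn_integral_suminf) (auto simp: nn_integral_cmult_indicator)
  also have "\<dots> = (\<Sum>j. ennreal (measure \<nu> {j} * s ^ j))"
    using s by (simp add: emeasure_eq_measure ennreal_mult mult.commute)
  finally have eq: "(\<integral>\<^sup>+i. ennreal (s ^ i) \<partial>\<nu>) = (\<Sum>j. ennreal (measure \<nu> {j} * s ^ j))" .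
  have le: "(\<integral>\<^sup>+i. ennreal (s ^ i) \<partial>\<nu>) \<le> 1"
    using s nn_integral_mono[of \<nu> "\<lambda>i. ennreal (s ^ i)" "\<lambda>_. 1"]
    by (simp add: power_le_one emeasure_space_1)
  have sm: "summable (\<lambda>j. measure \<nu> {j} * s ^ j)"
    using s le by (intro summable_suminf_not_top) (auto simp: eq[symmetric] top_unique)
  show "0 \<le> gen_fun \<nu> s"
    unfolding gen_fun_def using s by (intro suminf_nonneg sm) auto
  show "(\<integral>\<^sup>+i. ennreal (s ^ i) \<partial>\<nu>) = ennreal (gen_fun \<nu> s)"
    unfolding eq gen_fun_def using s sm by (intro suminf_ennreal2) auto
qed

lemma one_minus_times_geom_sum: "(1 - s) * (\<Sum>j<i. s ^ j) = 1 - (s::real) ^ i"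
  by (simp add: one_diff_power_eq)

text \<open>Both identities integrate \<open>(1 - s) * (\<Sum>j<i. s^j) = 1 - s^i\<close>, the
  second one after summing it over the exponents, where the mean 1 enters. The upper bounds replace
  powers of \<open>s\<close> by 1, and a vanishing slope would force \<open>i = 0\<close> almost
  surely.\<close>

lemma
  assumes \<nu>: "\<nu> \<in> space prob_measures_nat" "mean \<nu> = 1" and s: "0 \<le> s" "s \<le> 1"
  shows gen_fun_slope_le_1: "gen_fun_slope \<nu> s \<le> 1"
    and gen_fun_slope_pos: "0 < gen_fun_slope \<nu> s"
    and gen_fun_curv_le: "gen_fun_curv \<nu> s \<le> binom_moment \<nu>"
    and gen_fun_slope_eq: "gen_fun \<nu> s + (1 - s) * enn2real (gen_fun_slope \<nu> s) = 1"
    and gen_fun_curv_eq: "binom_moment \<nu> < \<infinity> \<Longrightarrow>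
      enn2real (gen_fun_slope \<nu> s) + (1 - s) * enn2real (gen_fun_curv \<nu> s) = 1"
proof -
  note \<nu>' = in_space_prob_measures_nat[OF \<nu>(1)]
  interpret prob_space \<nu> by (rule \<nu>'(1))
  note [measurable] = measurable_nat_measure[OF \<nu>'(2)]
  have slope_le: "(\<Sum>j<i. s ^ j) \<le> real i" for i
    using sum_mono[of "{..<i}" "\<lambda>j. s ^ j" "\<lambda>_. 1"] s by (simp add: power_le_one)
  have curv_le: "(\<Sum>j<i. \<Sum>l<j. s ^ l) \<le> real (i choose 2)" for i
    unfolding sum_nat_lessThan[symmetric] of_nat_sum by (intro sum_mono slope_le)
  have slope0: "0 \<le> (\<Sum>j<i. s ^ j)" for i using s by (auto intro: sum_nonneg)
  have curv0: "0 \<le> (\<Sum>j<i. \<Sum>l<j. s ^ l)" for i using slope0 by (auto intro: sum_nonneg)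
  have "gen_fun_slope \<nu> s \<le> mean \<nu>"
    unfolding gen_fun_slope_def mean_def ennreal_of_nat_eq_real_of_nat
    by (intro nn_integral_mono ennreal_leI slope_le)
  then show le1: "gen_fun_slope \<nu> s \<le> 1" using \<nu> by simp
  show "0 < gen_fun_slope \<nu> s"
  proof (rule ccontr)
    assume "\<not> 0 < gen_fun_slope \<nu> s"
    then have "AE i in \<nu>. ennreal (\<Sum>j<i. s ^ j) = 0"
      unfolding gen_fun_slope_def by (subst nn_integral_0_iff_AE[symmetric]) auto
    then have "AE i in \<nu>. of_nat i = (0 :: ennreal)"
    proof eventually_elim
      case (elim i)
      \<comment> \<open>The term \<open>j = 0\<close> is 1 even for \<open>s = 0\<close>, so a
        vanishing sum is empty.\<close>
      have "s ^ 0 \<le> (\<Sum>j<i. s ^ j)" if "0 < i" using s that by (intro member_le_sum) auto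
      with elim slope0[of i] show ?case by (cases "i = 0") auto
    qed
    then have "mean \<nu> = (\<integral>\<^sup>+i. 0 \<partial>\<nu>)" unfolding mean_def by (intro nn_integral_cong_AE)
    then show False using \<nu> by simp
  qed
  show curv: "gen_fun_curv \<nu> s \<le> binom_moment \<nu>"
    unfolding gen_fun_curv_def binom_moment_def ennreal_of_nat_eq_real_of_nat
    by (intro nn_integral_mono ennreal_leI curv_le)
  have slope: "gen_fun_slope \<nu> s = ennreal (enn2real (gen_fun_slope \<nu> s))"
    using le1 by (metis ennreal_enn2real ennreal_one_less_top le_less_trans)
  have "ennreal (gen_fun \<nu> s) + ennreal (1 - s) * gen_fun_slope \<nu> s
      = (\<integral>\<^sup>+i. ennreal (s ^ i) + ennreal (1 - s) * ennreal (\<Sum>j<i. s ^ j) \<partial>\<nu>)"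
    using s by (simp add: nn_integral_power_eq_gen_fun(1)[OF \<nu>(1) s, symmetric] gen_fun_slope_def nn_integral_add nn_integral_cmult)
  also have "\<dots> = (\<integral>\<^sup>+i. 1 \<partial>\<nu>)"
    using s slope0
    by (intro nn_integral_cong)
      (simp add: ennreal_mult[symmetric] ennreal_plus[symmetric] one_minus_times_geom_sum power_le_one del: ennreal_plus)
  also have "\<dots> = ennreal 1" by (simp add: emeasure_space_1)
  finally have "ennreal (gen_fun \<nu> s + (1 - s) * enn2real (gen_fun_slope \<nu> s)) = ennreal 1"
    using s nn_integral_power_eq_gen_fun(2)[OF \<nu>(1) s] by (subst (asm) slope) (simp add: ennreal_mult ennreal_plus)
  then show "gen_fun \<nu> s + (1 - s) * enn2real (gen_fun_slope \<nu> s) = 1"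
    using s nn_integral_power_eq_gen_fun(2)[OF \<nu>(1) s] by (subst (asm) ennreal_inj) auto
  \<comment> \<open>Finiteness enters here so that the curvature can be read as a real number;
    \<open>enn2real\<close> would turn an infinite value into 0.\<close>
  assume "binom_moment \<nu> < \<infinity>"
  then have curv': "gen_fun_curv \<nu> s = ennreal (enn2real (gen_fun_curv \<nu> s))"
    using curv by (metis ennreal_enn2real infinity_ennreal_def le_less_trans)
  have "gen_fun_slope \<nu> s + ennreal (1 - s) * gen_fun_curv \<nu> s
      = (\<integral>\<^sup>+i. ennreal (\<Sum>j<i. s ^ j) + ennreal (1 - s) * ennreal (\<Sum>j<i. \<Sum>l<j. s ^ l) \<partial>\<nu>)"
    using s by (simp add: gen_fun_slope_def gen_fun_curv_def nn_integral_add nn_integral_cmult)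
  also have "\<dots> = (\<integral>\<^sup>+i. of_nat i \<partial>\<nu>)"
  proof (intro nn_integral_cong)
    fix i
    have "(\<Sum>j<i. s ^ j) + (1 - s) * (\<Sum>j<i. \<Sum>l<j. s ^ l) = real i"
      unfolding sum_distrib_left[of "1 - s" "\<lambda>j. \<Sum>l<j. s ^ l" "{..<i}"] one_minus_times_geom_sum
      by (simp add: sum_subtractf)
    then show "ennreal (\<Sum>j<i. s ^ j) + ennreal (1 - s) * ennreal (\<Sum>j<i. \<Sum>l<j. s ^ l) = of_nat i"
      using s slope0 curv0
      by (simp add: ennreal_mult[symmetric] ennreal_plus[symmetric] ennreal_of_nat_eq_real_of_nat del: ennreal_plus)
  qed
  also have "\<dots> = ennreal 1" using \<nu>(2) by (simp add: mean_def)
  finally have "ennreal (enn2real (gen_fun_slope \<nu> s) + (1 - s) * enn2real (gen_fun_curv \<nu> s)) = ennreal 1"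
    using s by (subst (asm) slope, subst (asm) curv') (simp add: ennreal_mult ennreal_plus)
  then show "enn2real (gen_fun_slope \<nu> s) + (1 - s) * enn2real (gen_fun_curv \<nu> s) = 1"
    using s by (subst (asm) ennreal_inj) auto
qed

lemma gen_fun_slope_mono: "0 \<le> r \<Longrightarrow> r \<le> s \<Longrightarrow> gen_fun_slope \<nu> r \<le> gen_fun_slope \<nu> s"
  unfolding gen_fun_slope_def by (intro nn_integral_mono ennreal_leI sum_mono power_mono)

lemma gen_fun_curv_mono: "0 \<le> r \<Longrightarrow> r \<le> s \<Longrightarrow> gen_fun_curv \<nu> r \<le> gen_fun_curv \<nu> s"
  unfolding gen_fun_curv_def by (intro nn_integral_mono ennreal_leI sum_mono power_mono)

lemma gen_fun_mono:
  assumes "\<nu> \<in> space prob_measures_nat" "0 \<le> r" "r \<le> s" "s \<le> 1"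
  shows "gen_fun \<nu> r \<le> gen_fun \<nu> s"
proof -
  have "ennreal (gen_fun \<nu> r) \<le> ennreal (gen_fun \<nu> s)"
    using assms by (subst (1 2) nn_integral_power_eq_gen_fun(1)[symmetric])
      (auto intro!: nn_integral_mono ennreal_leI power_mono)
  then show ?thesis using assms nn_integral_power_eq_gen_fun(2)[of \<nu> s] by (simp add: ennreal_le_iff)
qed

text \<open>
  If the mean is 1, then \<open>shape_fun \<nu> s = gen_fun_curv \<nu> s / gen_fun_slope \<nu> s\<close>, where the numerator increases
  to \<open>binom_moment \<nu>\<close> and the denominator to 1 as \<open>s\<close> tends to 1. On \<open>[r,1)\<close> the quotient thus ranges
  in an interval of length at most \<open>binom_moment \<nu> / gen_fun_slope \<nu> r - gen_fun_curv \<nu> r\<close>; the other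
  term in the minimum provides domination.
\<close>

definition shape_bound :: "real \<Rightarrow> nat measure \<Rightarrow> ennreal" where
  "shape_bound r \<nu> = min (4 * binom_moment \<nu>) (binom_moment \<nu> / gen_fun_slope \<nu> r - gen_fun_curv \<nu> r)"

section \<open>Real-valued estimates for a law of mean 1 and finite variance\<close>

context
  fixes \<nu> :: "nat measure" and b :: real and q c :: "real \<Rightarrow> real"
  assumes \<nu>: "\<nu> \<in> space prob_measures_nat" "mean \<nu> = 1" and fin: "binom_moment \<nu> < \<infinity>"
  defines "b \<equiv> enn2real (binom_moment \<nu>)"
    and "q \<equiv> \<lambda>s. enn2real (gen_fun_slope \<nu> s)"
    and "c \<equiv> \<lambda>s. enn2real (gen_fun_curv \<nu> s)"
begin

lemma slope_curv_real:
  assumes "0 \<le> s" "s \<le> 1"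
  shows "ennreal (q s) = gen_fun_slope \<nu> s" "ennreal (c s) = gen_fun_curv \<nu> s"
    "0 < q s" "q s \<le> 1" "0 \<le> c s" "c s \<le> b" "q s + (1 - s) * c s = 1"
    "1 - gen_fun \<nu> s = (1 - s) * q s"
proof -
  note 1 = gen_fun_slope_le_1[OF \<nu> assms] gen_fun_slope_pos[OF \<nu> assms] gen_fun_curv_le[OF \<nu> assms]
  show q: "ennreal (q s) = gen_fun_slope \<nu> s"
    using 1 by (simp add: q_def le_less_trans[OF _ ennreal_one_less_top])
  show c: "ennreal (c s) = gen_fun_curv \<nu> s"
    using 1 fin by (simp add: c_def less_top le_less_trans)
  show "0 < q s" using 1(2) unfolding q[symmetric] by (simp add: ennreal_less_zero_iff)
  show "q s \<le> 1" using 1(1) unfolding q[symmetric] by simp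
  show "0 \<le> c s" by (simp add: c_def)
  show "c s \<le> b" unfolding c_def b_def using 1(3) fin by (intro enn2real_mono) auto
  show "q s + (1 - s) * c s = 1" unfolding q_def c_def by (rule gen_fun_curv_eq[OF \<nu> assms fin])
  show "1 - gen_fun \<nu> s = (1 - s) * q s"
    unfolding q_def using gen_fun_slope_eq[OF \<nu> assms] by linarith
qed

lemma shape_fun_eq:
  assumes "0 \<le> s" "s < 1"
  shows "shape_fun \<nu> s = c s / q s"
proof -
  have s: "0 \<le> s" "s \<le> 1" using assms by auto
  note 1 = slope_curv_real[OF s]
  have "shape_fun \<nu> s = (1 - q s) / ((1 - s) * q s)"
    unfolding shape_fun_def 1(8) using 1(3) assms by (simp add: divide_simps)
  also have "1 - q s = (1 - s) * c s" using 1(7) by simp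
  finally show ?thesis using assms by simp
qed

text \<open>
  Where \<open>1 - s > 1/(2b)\<close>, the slope \<open>q s\<close> may be close to 0. There the bound comes from
  the monotonicity of \<open>1 / (1 - gen_fun \<nu> s)\<close>, evaluated at \<open>1 - 1/(2b)\<close>.
\<close>

lemma shape_fun_le:
  assumes "0 \<le> s" "s < 1"
  shows "shape_fun \<nu> s \<le> 4 * b"
proof -
  \<comment> \<open>When \<open>2 * b * (1 - t)\<close> is at most 1, the slope
    \<open>q t = 1 - (1 - t) * c t\<close> is at least 1/2.\<close>
  have near: "shape_fun \<nu> t \<le> 2 * b" if t: "0 \<le> t" "t < 1" "2 * b * (1 - t) \<le> 1" for t
  proof -
    have t': "0 \<le> t" "t \<le> 1" using t by auto
    note 1 = slope_curv_real[OF t']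
    have "(1 - t) * c t \<le> (1 - t) * b" using t 1 by (intro mult_left_mono) auto
    then have "1 / 2 \<le> q t" using 1(7) t(3) by (simp add: algebra_simps)
    then have "c t / q t \<le> b / (1 / 2)" using 1 by (intro frac_le) auto
    then show ?thesis using shape_fun_eq t by simp
  qed
  have b0: "0 \<le> b" by (simp add: b_def)
  show ?thesis
  proof (cases "2 * b * (1 - s) \<le> 1")
    case True
    then show ?thesis using near[OF assms] b0 by linarith
  next
    case False
    define t where "t = 1 - 1 / (2 * b)"
    have b: "0 < b" using False b0 assms by (cases "b = 0") auto
    then have t1: "t < 1" "2 * b * (1 - t) \<le> 1" by (auto simp: t_def)
    have "1 / (2 * b) < 1 - s" using False b by (simp add: field_simps)
    then have st: "s < t" by (simp add: t_def)
    have t0: "0 \<le> t" using st assms by simp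
    have p: "0 < 1 - gen_fun \<nu> t"
      using slope_curv_real(3,8)[of t] t0 t1 by simp
    \<comment> \<open>The term \<open>1 / (1 - s)\<close> is dropped here; at \<open>t\<close> the
      corresponding term is \<open>1 / (1 - t) = 2 * b\<close>.\<close>
    have "shape_fun \<nu> s \<le> 1 / (1 - gen_fun \<nu> s)" unfolding shape_fun_def using assms by simp
    also have "\<dots> \<le> 1 / (1 - gen_fun \<nu> t)"
      using p gen_fun_mono[OF \<nu>(1), of s t] assms st t1 by (intro frac_le) auto
    also have "\<dots> = shape_fun \<nu> t + 2 * b" unfolding shape_fun_def using b by (simp add: t_def)
    also have "\<dots> \<le> 2 * b + 2 * b" using near[OF t0 t1] by simp
    finally show ?thesis by simp
  qed
qed

text \<open>\<open>ennreal\<close> clips negative reals at 0 exactly as subtraction of extended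
  nonnegative reals does, so the two differences agree whatever their sign.\<close>

lemma shape_bound_eq:
  assumes "0 \<le> r" "r < 1"
  shows "shape_bound r \<nu> = ennreal (min (4 * b) (b / q r - c r))"
proof -
  have r: "0 \<le> r" "r \<le> 1" using assms by auto
  note 1 = slope_curv_real[OF r]
  have b: "binom_moment \<nu> = ennreal b" using fin by (simp add: b_def)
  have "4 * ennreal b = ennreal (4 * b)" by (simp add: ennreal_mult b_def)
  moreover have "ennreal b / ennreal (q r) - ennreal (c r) = ennreal (b / q r - c r)"
    using 1(3,5) by (simp only: divide_ennreal ennreal_minus b_def enn2real_nonneg)
  ultimately show ?thesis
    unfolding shape_bound_def b 1(1,2)[symmetric] by (simp add: min_of_mono monoI ennreal_leI)
qed

lemma shape_modulus_le_shape_bound: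
  assumes "0 \<le> r" "r < 1"
  shows "shape_modulus \<nu> (1 - r) \<le> shape_bound r \<nu>"
proof -
  have r: "0 \<le> r" "r \<le> 1" using assms by auto
  have bounds: "c r \<le> shape_fun \<nu> s" "shape_fun \<nu> s \<le> b / q r" "0 \<le> shape_fun \<nu> s" "shape_fun \<nu> s \<le> 4 * b"
    if "r \<le> s" "s < 1" for s
  proof -
    have s: "0 \<le> s" "s \<le> 1" using that assms by auto
    note 1 = slope_curv_real[OF s] slope_curv_real[OF r]
    have "ennreal (q r) \<le> ennreal (q s)" "ennreal (c r) \<le> ennreal (c s)"
      unfolding 1 using that assms by (auto intro: gen_fun_slope_mono gen_fun_curv_mono)
    then have m: "q r \<le> q s" "c r \<le> c s" using 1(3,5) by (simp_all only: ennreal_le_iff less_imp_le)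
    have eq: "shape_fun \<nu> s = c s / q s" using s that by (intro shape_fun_eq)
    have "c s * q s \<le> c s * 1" using 1 by (intro mult_left_mono)
    then have "c s \<le> c s / q s" using 1 by (simp add: le_divide_eq)
    then show "c r \<le> shape_fun \<nu> s" using m eq by simp
    show "shape_fun \<nu> s \<le> b / q r" unfolding eq using 1 m by (intro frac_le) auto
    show "0 \<le> shape_fun \<nu> s" unfolding eq using 1 by simp
    show "shape_fun \<nu> s \<le> 4 * b" using s that by (intro shape_fun_le)
  qed
  \<comment> \<open>Both values lie in \<open>[c r, b / q r]\<close> and in
    \<open>[0, 4 * b]\<close>, so their distance is at most the smaller length.\<close>
  have "\<bar>shape_fun \<nu> s - shape_fun \<nu> t\<bar> \<le> min (4 * b) (b / q r - c r)"
    if "r \<le> s" "s \<le> t" "t < 1" for s t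
    using bounds[of s] bounds[of t] that by auto
  then show ?thesis
    unfolding shape_modulus_def shape_bound_eq[OF assms] by (auto intro!: SUP_least ennreal_leI)
qed

text \<open>By dominated convergence the slope tends to the mean, which is 1, and the curvature to
  \<open>b\<close>, so \<open>b / q r - c r\<close> tends to \<open>b / 1 - b = 0\<close>.\<close>

lemma shape_bound_tendsto_zero:
  "(\<lambda>m. shape_bound (1 - 1 / real (Suc m)) \<nu>) \<longlonglongrightarrow> 0"
proof -
  note \<nu>' = in_space_prob_measures_nat[OF \<nu>(1)]
  note [measurable] = measurable_nat_measure[OF \<nu>'(2)]
  define r where "r m = 1 - 1 / real (Suc m)" for m
  have r: "0 \<le> r m" "r m < 1" "r m \<le> 1" for m by (auto simp: r_def)
  have rlim: "r \<longlonglongrightarrow> 1"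
    unfolding r_def using tendsto_diff[OF tendsto_const LIMSEQ_inverse_real_of_nat, of 1]
    by (simp add: inverse_eq_divide)
  have slope_le: "(\<Sum>j<i. r m ^ j) \<le> real i" for i m
    using sum_mono[of "{..<i}" "\<lambda>j. r m ^ j" "\<lambda>_. 1"] r by (simp add: power_le_one)
  have curv_le: "(\<Sum>j<i. \<Sum>l<j. r m ^ l) \<le> real (i choose 2)" for i m
    unfolding sum_nat_lessThan[symmetric] of_nat_sum by (intro sum_mono slope_le)
  have "(\<lambda>m. gen_fun_slope \<nu> (r m)) \<longlonglongrightarrow> (\<integral>\<^sup>+i. ennreal (\<Sum>j<i. 1 ^ j) \<partial>\<nu>)"
    unfolding gen_fun_slope_def
  proof (rule nn_integral_dominated_convergence[where w = of_nat])
    show "AE i in \<nu>. (\<lambda>m. ennreal (\<Sum>j<i. r m ^ j)) \<longlonglongrightarrow> ennreal (\<Sum>j<i. 1 ^ j)"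
      by (intro AE_I2 tendsto_intros rlim)
  qed (use \<nu>(2) slope_le in \<open>auto simp: mean_def ennreal_of_nat_eq_real_of_nat intro!: ennreal_leI\<close>)
  also have "(\<integral>\<^sup>+i. ennreal (\<Sum>j<i. 1 ^ j) \<partial>\<nu>) = ennreal 1"
    using \<nu>(2) by (simp add: mean_def ennreal_of_nat_eq_real_of_nat)
  finally have qlim: "(\<lambda>m. q (r m)) \<longlonglongrightarrow> 1" unfolding q_def by (intro tendsto_enn2real) simp_all
  have "(\<lambda>m. gen_fun_curv \<nu> (r m)) \<longlonglongrightarrow> (\<integral>\<^sup>+i. ennreal (\<Sum>j<i. \<Sum>l<j. 1 ^ l) \<partial>\<nu>)"
    unfolding gen_fun_curv_def
  proof (rule nn_integral_dominated_convergence[where w = "\<lambda>i. of_nat (i choose 2)"])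
    show "AE i in \<nu>. (\<lambda>m. ennreal (\<Sum>j<i. \<Sum>l<j. r m ^ l)) \<longlonglongrightarrow> ennreal (\<Sum>j<i. \<Sum>l<j. 1 ^ l)"
      by (intro AE_I2 tendsto_intros rlim)
  qed (use fin curv_le in \<open>auto simp: binom_moment_def ennreal_of_nat_eq_real_of_nat intro!: ennreal_leI\<close>)
  also have "(\<integral>\<^sup>+i. ennreal (\<Sum>j<i. \<Sum>l<j. 1 ^ l) \<partial>\<nu>) = ennreal b"
    using fin by (simp add: b_def binom_moment_def ennreal_of_nat_eq_real_of_nat sum_nat_lessThan[symmetric])
  finally have clim: "(\<lambda>m. c (r m)) \<longlonglongrightarrow> b"
    unfolding c_def by (intro tendsto_enn2real) (simp_all add: b_def)
  have "(\<lambda>m. ennreal (min (4 * b) (b / q (r m) - c (r m)))) \<longlonglongrightarrow> ennreal (min (4 * b) (b / 1 - b))"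
    by (intro tendsto_intros qlim clim) simp
  also have "min (4 * b) (b / 1 - b) = 0" by (simp add: b_def)
  finally show ?thesis using shape_bound_eq[OF r(1,2)] by (simp add: r_def)
qed

end

text \<open>\<open>shape_modulus\<close> is a supremum over uncountably many pairs. Its upper bound
  \<open>shape_bound\<close> is built from three integrals of known measurability and can be fed to
  the strong law.\<close>

lemma shape_bound_measurable:
  assumes "sets \<Lambda> = sets prob_measures_nat"
  shows "shape_bound r \<in> borel_measurable \<Lambda>"
proof -
  note [measurable] = nn_integral_measurable_prob_measures_nat[OF assms]
  show ?thesis
    unfolding shape_bound_def binom_moment_def gen_fun_slope_def gen_fun_curv_def by measurable
qed

section \<open>Windows and diagonal sequences\<close>

text \<open>The quotient is the average up to \<open>N n\<close> times \<open>N n / u n\<close>, and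
  the latter tends to \<open>c\<close>.\<close>

lemma average_reindex:
  fixes x u :: "nat \<Rightarrow> real"
  assumes avg: "(\<lambda>n. (\<Sum>k<n. x k) / real n) \<longlonglongrightarrow> m"
    and u: "filterlim u at_top sequentially"
    and c: "0 \<le> c" and N: "\<And>n. \<bar>real (N n) - c * u n\<bar> \<le> 1"
  shows "(\<lambda>n. (\<Sum>k<N n. x k) / u n) \<longlonglongrightarrow> m * c"
proof -
  have inv: "(\<lambda>n. inverse (u n)) \<longlonglongrightarrow> 0"
    using u by (intro tendsto_inverse_0_at_top)
  have upos: "\<forall>\<^sub>F n in sequentially. 0 < u n"
    using u by (auto simp: filterlim_at_top_dense)
  show ?thesis
  proof (cases "c = 0")
    case True
    \<comment> \<open>Here \<open>N n\<close> is 0 or 1 instead of tending to infinity, so the sum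
      stays bounded. This case serves windows that start at 0.\<close>
    have "\<forall>\<^sub>F n in sequentially. norm ((\<Sum>k<N n. x k) / u n) \<le> \<bar>x 0\<bar> * inverse (u n)"
      using upos
    proof eventually_elim
      case (elim n)
      have "N n = 0 \<or> N n = 1" using N[of n] True by auto
      then have "\<bar>\<Sum>k<N n. x k\<bar> \<le> \<bar>x 0\<bar>" by auto
      then show ?case using elim by (simp add: abs_mult divide_inverse mult_right_mono)
    qed
    moreover have "(\<lambda>n. \<bar>x 0\<bar> * inverse (u n)) \<longlonglongrightarrow> 0"
      using tendsto_mult_right_zero[OF inv] .
    ultimately show ?thesis using True by (simp add: Lim_null_comparison)
  next
    case False
    with c have c: "0 < c" by simp
    have "(\<lambda>n. real (N n) / u n - c) \<longlonglongrightarrow> 0"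
    proof (rule Lim_null_comparison[OF _ inv])
      show "\<forall>\<^sub>F n in sequentially. norm (real (N n) / u n - c) \<le> inverse (u n)"
        using upos
      proof eventually_elim
        case (elim n)
        have "real (N n) / u n - c = (real (N n) - c * u n) / u n" using elim by (simp add: field_simps)
        then have "\<bar>real (N n) / u n - c\<bar> = \<bar>real (N n) - c * u n\<bar> / u n" using elim by simp
        also have "\<dots> \<le> 1 / u n" using N[of n] elim by (intro divide_right_mono) auto
        finally show ?case by (simp add: inverse_eq_divide)
      qed
    qed
    then have ratio: "(\<lambda>n. real (N n) / u n) \<longlonglongrightarrow> c" by (simp add: LIM_zero_iff)
    have "filterlim (\<lambda>n. c * u n - 1) at_top sequentially"
      using filterlim_tendsto_add_at_top[OF tendsto_const[of "-1"]
          filterlim_tendsto_pos_mult_at_top[OF tendsto_const[of c] c u]] by simp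
    then have "filterlim (\<lambda>n. real (N n)) at_top sequentially"
      by (rule filterlim_at_top_mono) (use N in \<open>auto simp: abs_le_iff algebra_simps intro!: always_eventually\<close>)
    then have Ntop: "filterlim N at_top sequentially"
      by (simp add: filterlim_sequentially_iff_filterlim_real)
    have "(\<lambda>n. (\<Sum>k<N n. x k) / real (N n) * (real (N n) / u n)) \<longlonglongrightarrow> m * c"
      by (intro tendsto_mult ratio filterlim_compose[OF avg Ntop])
    then show ?thesis
    proof (rule Lim_transform_eventually)
      have "\<forall>\<^sub>F n in sequentially. Suc 0 \<le> N n" using Ntop unfolding filterlim_at_top by blast
      then show "\<forall>\<^sub>F n in sequentially. (\<Sum>k<N n. x k) / real (N n) * (real (N n) / u n) = (\<Sum>k<N n. x k) / u n"
        by eventually_elim simp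
    qed
  qed
qed

text \<open>From some rank \<open>N K\<close> on, \<open>A K\<close> is below \<open>1/(K+1)\<close>
  in absolute value. The value \<open>h n\<close> is the largest \<open>K\<close> up to
  \<open>n\<close> whose rank has been reached by \<open>n\<close>.\<close>

lemma diagonal_tendsto_zero:
  fixes A :: "nat \<Rightarrow> nat \<Rightarrow> real"
  assumes "\<And>K. A K \<longlonglongrightarrow> 0"
  shows "\<exists>h. filterlim h at_top sequentially \<and> (\<lambda>n. A (h n) n) \<longlonglongrightarrow> 0"
proof -
  have "\<exists>N. \<forall>n\<ge>N. \<bar>A K n\<bar> < inverse (real (Suc K))" for K
    using LIMSEQ_D[OF assms[of K], of "inverse (real (Suc K))"] by simp
  then obtain N where N: "\<And>K n. N K \<le> n \<Longrightarrow> \<bar>A K n\<bar> < inverse (real (Suc K))" by metis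
  define S where "S n = {K. K \<le> n \<and> N K \<le> n}" for n
  \<comment> \<open>Inserting 0 keeps the maximum defined when \<open>S n\<close> is empty; from
    \<open>N 0\<close> on, 0 belongs to \<open>S n\<close> itself.\<close>
  define h where "h n = Max (insert 0 (S n))" for n
  have fin: "finite (S n)" for n unfolding S_def by simp
  have top: "filterlim h at_top sequentially"
    unfolding filterlim_at_top
  proof
    fix K
    show "\<forall>\<^sub>F n in sequentially. K \<le> h n"
      using eventually_ge_at_top[of K] eventually_ge_at_top[of "N K"]
      by eventually_elim (auto simp: h_def S_def intro!: Max_ge)
  qed
  have "(\<lambda>n. A (h n) n) \<longlonglongrightarrow> 0"
  proof (rule Lim_null_comparison)
    show "(\<lambda>n. inverse (real (Suc (h n)))) \<longlonglongrightarrow> 0"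
      by (rule filterlim_compose[OF LIMSEQ_inverse_real_of_nat top])
    show "\<forall>\<^sub>F n in sequentially. norm (A (h n) n) \<le> inverse (real (Suc (h n)))"
      using eventually_ge_at_top[of "N 0"]
    proof eventually_elim
      case (elim n)
      have "h n \<in> insert 0 (S n)" unfolding h_def using fin by (intro Max_in) auto
      then have "N (h n) \<le> n" using elim by (auto simp: S_def)
      from N[OF this] show ?case by simp
    qed
  qed
  with top show ?thesis by blast
qed

lemma sum_divide_ennreal:
  assumes "\<And>k. k \<in> A \<Longrightarrow> y k < (\<infinity>::ennreal)" "0 < c"
  shows "(\<Sum>k\<in>A. y k) / ennreal c = ennreal ((\<Sum>k\<in>A. enn2real (y k)) / c)"
proof -
  have "(\<Sum>k\<in>A. y k) = (\<Sum>k\<in>A. ennreal (enn2real (y k)))"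
    using assms by (intro sum.cong) (auto simp: less_top)
  then show ?thesis using assms by (simp add: sum_ennreal divide_ennreal sum_nonneg)
qed

text \<open>By contradiction: under a law of mean 1 without mass at 0, \<open>i - 1\<close> is
  nonnegative with mean 0, so the law is the point mass at 1 and its binomial moment
  vanishes.\<close>

lemma emeasure_zero_pos:
  assumes \<Lambda>: "sets \<Lambda> = sets prob_measures_nat"
    and mean1: "AE \<nu> in \<Lambda>. mean \<nu> = 1"
    and pos: "(\<integral>\<^sup>+\<nu>. binom_moment \<nu> \<partial>\<Lambda>) \<noteq> 0"
  shows "(\<integral>\<^sup>+\<nu>. emeasure \<nu> {0} \<partial>\<Lambda>) \<noteq> 0"
proof
  assume 0: "(\<integral>\<^sup>+\<nu>. emeasure \<nu> {0} \<partial>\<Lambda>) = 0"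
  note m = nn_integral_measurable_prob_measures_nat[OF \<Lambda>]
  have space: "AE \<nu> in \<Lambda>. \<nu> \<in> space prob_measures_nat"
    using AE_space[of \<Lambda>] sets_eq_imp_space_eq[OF \<Lambda>] by simp
  have "(\<integral>\<^sup>+\<nu>. (\<integral>\<^sup>+i. indicator {0} i \<partial>\<nu>) \<partial>\<Lambda>) = (\<integral>\<^sup>+\<nu>. emeasure \<nu> {0} \<partial>\<Lambda>)"
    by (rule nn_integral_cong_AE)
      (use space in eventually_elim, auto dest: in_space_prob_measures_nat)
  with 0 have "AE \<nu> in \<Lambda>. (\<integral>\<^sup>+i. indicator {0::nat} i \<partial>\<nu>) = 0"
    by (subst nn_integral_0_iff_AE[symmetric]) (auto intro: m)
  with mean1 space have "AE \<nu> in \<Lambda>. binom_moment \<nu> = 0"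
  proof eventually_elim
    case (elim \<nu>)
    note \<nu> = in_space_prob_measures_nat[OF elim(2)]
    interpret prob_space \<nu> by (rule \<nu>(1))
    note [measurable] = measurable_nat_measure[OF \<nu>(2)]
    \<comment> \<open>Subtraction in \<open>nat\<close> gives \<open>1 + (i - 1) = i\<close> except
      at \<open>i = 0\<close>, where the excess of 1 is the indicator.\<close>
    have "1 + (\<integral>\<^sup>+i. of_nat (i - 1) \<partial>\<nu>) = (\<integral>\<^sup>+i. 1 + of_nat (i - 1) \<partial>\<nu>)"
      by (simp add: nn_integral_add emeasure_space_1)
    also have "\<dots> = (\<integral>\<^sup>+i. of_nat i + indicator {0} i \<partial>\<nu>)"
      by (intro nn_integral_cong) (auto simp: indicator_def simp flip: of_nat_Suc)
    also have "\<dots> = 1 + 0" using elim by (simp add: nn_integral_add mean_def)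
    finally have "(\<integral>\<^sup>+i. of_nat (i - 1) \<partial>\<nu>) = (0 :: ennreal)" by simp
    then have "AE i in \<nu>. of_nat (i - 1) = (0 :: ennreal)"
      by (subst nn_integral_0_iff_AE[symmetric]) auto
    then have "AE i in \<nu>. of_nat (i choose 2) = (0 :: ennreal)" by eventually_elim simp
    then show ?case unfolding binom_moment_def by (subst nn_integral_0_iff_AE) auto
  qed
  then have "(\<integral>\<^sup>+\<nu>. binom_moment \<nu> \<partial>\<Lambda>) = 0"
    by (subst nn_integral_0_iff_AE) (auto intro: binom_moment_measurable[OF \<Lambda>])
  with pos show False by simp
qed

lemma
  assumes "0 \<le> (y::real)"
  shows nat_floor_close: "\<bar>real (nat \<lfloor>y\<rfloor>) - y\<bar> \<le> 1"
    and Suc_nat_floor_close: "\<bar>real (Suc (nat \<lfloor>y\<rfloor>)) - y\<bar> \<le> 1"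
proof -
  have "real (nat \<lfloor>y\<rfloor>) = of_int \<lfloor>y\<rfloor>" using assms by simp
  moreover have "of_int \<lfloor>y\<rfloor> \<le> y" "y \<le> of_int \<lfloor>y\<rfloor> + 1" by linarith+
  ultimately show "\<bar>real (nat \<lfloor>y\<rfloor>) - y\<bar> \<le> 1" "\<bar>real (Suc (nat \<lfloor>y\<rfloor>)) - y\<bar> \<le> 1"
    unfolding of_nat_Suc by linarith+
qed

text \<open>For fixed \<open>K\<close>, take windows of length \<open>(K+1) * sqrt n\<close> and
  thresholds \<open>n / (K+1)\<close>. The thresholds eventually exceed any \<open>L\<close>, so the
  normalized sums are asymptotically at most \<open>(K+1) * \<delta> L\<close> with \<open>L\<close>
  arbitrary. Since one \<open>K\<close> governs window and threshold, a single diagonal choice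
  handles every \<open>\<epsilon>\<close>.\<close>

lemma truncated_second_moment_windows:
  fixes \<mu> :: "nat \<Rightarrow> nat measure"
  defines "T \<equiv> \<lambda>a \<nu>. \<integral>\<^sup>+i. ennreal ((real i)\<^sup>2) * indicator {i. a \<le> (real i)\<^sup>2} i \<partial>\<nu>"
  assumes fin: "\<And>k. T 0 (\<mu> k) < \<infinity>"
    and avg: "\<And>L::nat. (\<lambda>n. (\<Sum>k<n. enn2real (T (real L) (\<mu> k))) / real n) \<longlonglongrightarrow> \<delta> L"
    and \<delta>: "\<delta> \<longlonglongrightarrow> 0"
  shows "\<exists>h :: nat \<Rightarrow> real. filterlim h at_top sequentially \<and>
    (\<forall>\<epsilon>>0. (\<lambda>n. (\<Sum>k = 0..nat \<lfloor>h n * sqrt (real n)\<rfloor>. T (\<epsilon> * real n) (\<mu> k)) / ennreal (sqrt (real n)))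
      \<longlonglongrightarrow> 0)"
proof -
  have anti: "T a' \<nu> \<le> T a \<nu>" if "a \<le> a'" for a a' \<nu>
    unfolding T_def using that by (intro nn_integral_mono mult_left_mono) (auto simp: indicator_def)
  have T_fin: "T a (\<mu> k) < \<infinity>" if "0 \<le> a" for a k
    using anti[OF that, of "\<mu> k"] fin[of k] by (rule le_less_trans)
  define A where "A K n = (\<Sum>k = 0..nat \<lfloor>real (Suc K) * sqrt (real n)\<rfloor>.
      enn2real (T (real n / real (Suc K)) (\<mu> k))) / sqrt (real n)" for K n
  have sqrt_top: "filterlim (\<lambda>n. sqrt (real n)) at_top sequentially"
    by (rule filterlim_compose[OF sqrt_at_top filterlim_real_sequentially])
  have "A K \<longlonglongrightarrow> 0" for K
  proof (rule order_tendstoI)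
    fix e :: real assume "e < 0"
    then show "\<forall>\<^sub>F n in sequentially. e < A K n"
      by (intro always_eventually allI)
        (auto simp: A_def intro!: less_le_trans[OF _ divide_nonneg_nonneg] sum_nonneg)
  next
    fix e :: real assume "0 < e"
    moreover have "(\<lambda>L. \<delta> L * real (Suc K)) \<longlonglongrightarrow> 0 * real (Suc K)" by (intro tendsto_intros \<delta>)
    ultimately have "\<forall>\<^sub>F L in sequentially. \<delta> L * real (Suc K) < e"
      by (intro order_tendstoD(2)) auto
    then obtain L where L: "\<delta> L * real (Suc K) < e"
      by (auto simp: eventually_sequentially)
    let ?N = "\<lambda>n. Suc (nat \<lfloor>real (Suc K) * sqrt (real n)\<rfloor>)"
    have N: "\<bar>real (?N n) - real (Suc K) * sqrt (real n)\<bar> \<le> 1" for n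
      by (rule Suc_nat_floor_close) simp
    have "(\<lambda>n. (\<Sum>k<?N n. enn2real (T (real L) (\<mu> k))) / sqrt (real n)) \<longlonglongrightarrow> \<delta> L * real (Suc K)"
      by (rule average_reindex[OF avg sqrt_top _ N]) simp
    from order_tendstoD(2)[OF this L] eventually_ge_at_top[of "L * Suc K"]
    show "\<forall>\<^sub>F n in sequentially. A K n < e"
    proof eventually_elim
      case (elim n)
      have "real L * real (Suc K) \<le> real n" using elim(2) by (metis of_nat_le_iff of_nat_mult)
      then have "real L \<le> real n / real (Suc K)" by (simp add: le_divide_eq)
      then have "A K n \<le> (\<Sum>k = 0..nat \<lfloor>real (Suc K) * sqrt (real n)\<rfloor>. enn2real (T (real L) (\<mu> k))) / sqrt (real n)"
        unfolding A_def using T_fin[of "real L"]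
        by (intro divide_right_mono sum_mono enn2real_mono anti) auto
      also have "{0..nat \<lfloor>real (Suc K) * sqrt (real n)\<rfloor>} = {..<?N n}" by auto
      finally show ?case using elim(1) by simp
    qed
  qed
  from diagonal_tendsto_zero[of A, OF this] obtain h
    where h: "filterlim h at_top sequentially" and lim: "(\<lambda>n. A (h n) n) \<longlonglongrightarrow> 0" by blast
  define H where "H n = real (Suc (h n))" for n
  have H: "filterlim H at_top sequentially"
    unfolding H_def by (intro filterlim_compose[OF filterlim_real_sequentially] filterlim_compose[OF filterlim_Suc h])
  moreover have "(\<lambda>n. (\<Sum>k = 0..nat \<lfloor>H n * sqrt (real n)\<rfloor>. T (\<epsilon> * real n) (\<mu> k)) / ennreal (sqrt (real n)))
      \<longlonglongrightarrow> 0" if "0 < \<epsilon>" for \<epsilon>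
  proof (rule tendsto_sandwich[OF _ _ tendsto_const])
    show "(\<lambda>n. ennreal (A (h n) n)) \<longlonglongrightarrow> 0"
      using tendsto_ennrealI[OF lim] by simp
    \<comment> \<open>Once \<open>H n\<close> reaches \<open>1/\<epsilon>\<close>, the threshold
      \<open>n / H n\<close> is below \<open>\<epsilon> * n\<close>, and the sum with the higher
      threshold is the smaller one.\<close>
    have "\<forall>\<^sub>F n in sequentially. inverse \<epsilon> \<le> H n" using H by (simp add: filterlim_at_top)
    then show "\<forall>\<^sub>F n in sequentially. (\<Sum>k = 0..nat \<lfloor>H n * sqrt (real n)\<rfloor>. T (\<epsilon> * real n) (\<mu> k))
        / ennreal (sqrt (real n)) \<le> ennreal (A (h n) n)"
      using eventually_gt_at_top[of 0]
    proof eventually_elim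
      case (elim n)
      have Hn: "0 < H n" by (simp add: H_def)
      then have "1 \<le> H n * \<epsilon>" using elim(1) that by (simp add: inverse_eq_divide divide_le_eq)
      then have "1 * real n \<le> H n * \<epsilon> * real n" by (intro mult_right_mono) auto
      then have "real n / H n \<le> \<epsilon> * real n" using Hn by (simp add: divide_le_eq mult_ac)
      then have "(\<Sum>k = 0..nat \<lfloor>H n * sqrt (real n)\<rfloor>. T (\<epsilon> * real n) (\<mu> k)) / ennreal (sqrt (real n))
          \<le> (\<Sum>k = 0..nat \<lfloor>H n * sqrt (real n)\<rfloor>. T (real n / H n) (\<mu> k)) / ennreal (sqrt (real n))"
        by (intro divide_right_mono_ennreal sum_mono anti)
      also have "\<dots> = ennreal (A (h n) n)"
        unfolding A_def H_def[symmetric] using elim Hn T_fin by (intro sum_divide_ennreal) auto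
      finally show ?case .
    qed
  qed simp
  ultimately show ?thesis by blast
qed

text \<open>The window is a difference of two initial segments, whose sums divided by
  \<open>k\<close> tend to \<open>c * b\<close> and \<open>c * a\<close>. The closed upper end
  accounts for the \<open>Suc\<close>.\<close>

lemma window_average_tendsto:
  fixes x :: "nat \<Rightarrow> real"
  assumes avg: "(\<lambda>n. (\<Sum>k<n. x k) / real n) \<longlonglongrightarrow> c" and ab: "0 \<le> a" "a < b"
  shows "(\<lambda>k. (\<Sum>j = nat \<lfloor>a * real k\<rfloor>..nat \<lfloor>b * real k\<rfloor>. x j) / ((b - a) * real k)) \<longlonglongrightarrow> c"
proof -
  have "(\<lambda>k. ((\<Sum>j<Suc (nat \<lfloor>b * real k\<rfloor>). x j) / real k - (\<Sum>j<nat \<lfloor>a * real k\<rfloor>. x j) / real k) / (b - a))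
      \<longlonglongrightarrow> (c * b - c * a) / (b - a)"
    using ab by (intro tendsto_intros average_reindex[OF avg filterlim_real_sequentially]
        nat_floor_close Suc_nat_floor_close) auto
  also have "(c * b - c * a) / (b - a) = c" using ab by (simp add: right_diff_distrib[symmetric])
  also have "(\<lambda>k. ((\<Sum>j<Suc (nat \<lfloor>b * real k\<rfloor>). x j) / real k - (\<Sum>j<nat \<lfloor>a * real k\<rfloor>. x j) / real k) / (b - a))
      = (\<lambda>k. (\<Sum>j = nat \<lfloor>a * real k\<rfloor>..nat \<lfloor>b * real k\<rfloor>. x j) / ((b - a) * real k))"
  proof
    fix k
    have "(\<Sum>j<Suc M. x j) = (\<Sum>j<N. x j) + (\<Sum>j = N..M. x j)" if "N \<le> M" for N M
    proof -
      have "{..<Suc M} = {..<N} \<union> {N..M}" using that by auto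
      then have "(\<Sum>j<Suc M. x j) = sum x ({..<N} \<union> {N..M})" by (rule arg_cong)
      also have "\<dots> = (\<Sum>j<N. x j) + (\<Sum>j = N..M. x j)" by (rule sum.union_disjoint) auto
      finally show ?thesis .
    qed
    moreover have "nat \<lfloor>a * real k\<rfloor> \<le> nat \<lfloor>b * real k\<rfloor>"
      using ab by (intro nat_mono floor_mono mult_right_mono) auto
    ultimately have "(\<Sum>j<Suc (nat \<lfloor>b * real k\<rfloor>). x j)
        = (\<Sum>j<nat \<lfloor>a * real k\<rfloor>. x j) + (\<Sum>j = nat \<lfloor>a * real k\<rfloor>..nat \<lfloor>b * real k\<rfloor>. x j)"
      by blast
    then show "((\<Sum>j<Suc (nat \<lfloor>b * real k\<rfloor>). x j) / real k - (\<Sum>j<nat \<lfloor>a * real k\<rfloor>. x j) / real k) / (b - a)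
      = (\<Sum>j = nat \<lfloor>a * real k\<rfloor>..nat \<lfloor>b * real k\<rfloor>. x j) / ((b - a) * real k)"
      by (simp only: diff_divide_distrib[symmetric] add_diff_cancel_left' divide_divide_eq_left mult.commute)
  qed
  finally show ?thesis .
qed

lemma shape_modulus_mono: "\<epsilon> \<le> \<epsilon>' \<Longrightarrow> shape_modulus \<nu> \<epsilon> \<le> shape_modulus \<nu> \<epsilon>'"
  unfolding shape_modulus_def by (intro SUP_subset_mono) auto

text \<open>One level \<open>1/(m+1)\<close> with \<open>\<delta> m < e\<close> is enough: the
  modulus there is dominated by \<open>shape_bound\<close>, and it only decreases for smaller
  \<open>\<epsilon>\<close>.\<close>

lemma shape_modulus_limsup:
  fixes \<mu> :: "nat \<Rightarrow> nat measure"
  assumes \<mu>: "\<And>k. \<mu> k \<in> space prob_measures_nat" "\<And>k. mean (\<mu> k) = 1" "\<And>k. binom_moment (\<mu> k) < \<infinity>"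
    and fin: "\<And>m k. shape_bound (1 - 1 / real (Suc m)) (\<mu> k) < \<infinity>"
    and avg: "\<And>m. (\<lambda>n. (\<Sum>k<n. enn2real (shape_bound (1 - 1 / real (Suc m)) (\<mu> k))) / real n) \<longlonglongrightarrow> \<delta> m"
    and \<delta>: "\<delta> \<longlonglongrightarrow> 0"
  shows "((\<lambda>\<epsilon>. limsup (\<lambda>n. (\<Sum>k = 0..n. shape_modulus (\<mu> k) \<epsilon>) / of_nat n)) \<longlongrightarrow> 0) (at_right 0)"
proof (rule order_tendstoI)
  fix e :: ennreal assume "0 < e"
  define F where "F \<epsilon> = limsup (\<lambda>n. (\<Sum>k = 0..n. shape_modulus (\<mu> k) \<epsilon>) / of_nat n)" for \<epsilon>
  have "(\<lambda>m. ennreal (\<delta> m)) \<longlonglongrightarrow> 0" using tendsto_ennrealI[OF \<delta>] by simp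
  from order_tendstoD(2)[OF this \<open>0 < e\<close>] obtain m where m: "ennreal (\<delta> m) < e"
    by (auto simp: eventually_sequentially)
  define \<epsilon>0 where "\<epsilon>0 = 1 / real (Suc m)"
  have "0 < \<epsilon>0" by (simp add: \<epsilon>0_def)
  let ?g = "\<lambda>k. shape_bound (1 - \<epsilon>0) (\<mu> k)"
  have g: "shape_modulus (\<mu> k) \<epsilon>0 \<le> ?g k" for k
    using shape_modulus_le_shape_bound[OF \<mu>(1-3), of "1 - \<epsilon>0"] by (simp add: \<epsilon>0_def)
  \<comment> \<open>There are \<open>n + 1\<close> terms but the divisor is \<open>n\<close>;
    reindexing with factor 1 absorbs the discrepancy.\<close>
  have "(\<lambda>n. (\<Sum>k<Suc n. enn2real (?g k)) / real n) \<longlonglongrightarrow> \<delta> m * 1"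
    unfolding \<epsilon>0_def by (rule average_reindex[OF avg filterlim_real_sequentially]) auto
  then have "(\<lambda>n. ennreal ((\<Sum>k = 0..n. enn2real (?g k)) / real n)) \<longlonglongrightarrow> ennreal (\<delta> m)"
    by (intro tendsto_ennrealI) (simp add: lessThan_Suc_atMost atMost_atLeast0 del: sum.lessThan_Suc)
  then have "(\<lambda>n. (\<Sum>k = 0..n. ?g k) / of_nat n) \<longlonglongrightarrow> ennreal (\<delta> m)"
  proof (rule Lim_transform_eventually)
    show "\<forall>\<^sub>F n in sequentially. ennreal ((\<Sum>k = 0..n. enn2real (?g k)) / real n) = (\<Sum>k = 0..n. ?g k) / of_nat n"
      using eventually_gt_at_top[of 0]
    proof eventually_elim
      case (elim n)
      then show ?case
        unfolding ennreal_of_nat_eq_real_of_nat using fin[of m]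
        by (intro sum_divide_ennreal[symmetric]) (auto simp: \<epsilon>0_def)
    qed
  qed
  then have "limsup (\<lambda>n. (\<Sum>k = 0..n. ?g k) / of_nat n) = ennreal (\<delta> m)"
    by (intro lim_imp_Limsup) auto
  moreover have "F \<epsilon>0 \<le> limsup (\<lambda>n. (\<Sum>k = 0..n. ?g k) / of_nat n)"
    unfolding F_def by (intro Limsup_mono always_eventually allI divide_right_mono_ennreal sum_mono g)
  ultimately have F0: "F \<epsilon>0 < e" using m by simp
  have F_mono: "F \<epsilon> \<le> F \<epsilon>0" if "\<epsilon> \<le> \<epsilon>0" for \<epsilon>
    unfolding F_def using that
    by (intro Limsup_mono always_eventually allI divide_right_mono_ennreal sum_mono shape_modulus_mono)
  have "\<forall>\<^sub>F \<epsilon> in at_right 0. \<epsilon> < \<epsilon>0"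
    using \<open>0 < \<epsilon>0\<close> by (auto simp: eventually_at_right)
  then have "\<forall>\<^sub>F \<epsilon> in at_right 0. F \<epsilon> < e"
    by eventually_elim (rule le_less_trans[OF F_mono F0], simp)
  then show "\<forall>\<^sub>F \<epsilon> in at_right 0. limsup (\<lambda>n. (\<Sum>k = 0..n. shape_modulus (\<mu> k) \<epsilon>) / of_nat n) < e"
    by (simp add: F_def)
qed simp

section \<open>Proof of the theorem\<close>

theorem lemma3p2:
  fixes \<Lambda> :: "nat measure measure" and \<sigma>2 :: real
  assumes "prob_space \<Lambda>"
    and "sets \<Lambda> = sets prob_measures_nat"
    and "AE \<mu> in environment_law \<Lambda>. mean (\<mu> 0) = 1"
    and "(\<integral>\<^sup>+ \<mu>. var (\<mu> 0) \<partial>environment_law \<Lambda>) = ennreal \<sigma>2"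
    and "0 < \<sigma>2"
  shows "\<exists>c>0. AE \<mu> in environment_law \<Lambda>.
      (0 < \<sigma>2 \<and> (\<lambda>n. (\<Sum>k<n. var (\<mu> k)) / of_nat n) \<longlonglongrightarrow> ennreal \<sigma>2)
    \<and> (\<forall>a b :: real. 0 \<le> a \<longrightarrow> a < b \<longrightarrow>
         ereal c \<le> liminf (\<lambda>k. ereal
           ((\<Sum>j = nat \<lfloor>a * real k\<rfloor>..nat \<lfloor>b * real k\<rfloor>. measure (\<mu> j) {0}) / ((b - a) * real k))))
    \<and> (\<exists>h :: nat \<Rightarrow> real. filterlim h at_top sequentially \<and>
         (\<forall>\<epsilon>>0. (\<lambda>n. (\<Sum>k = 0..nat \<lfloor>h n * sqrt (real n)\<rfloor>.
             \<integral>\<^sup>+ i. ennreal ((real i)\<^sup>2) * indicator {i. \<epsilon> * real n \<le> (real i)\<^sup>2} i \<partial>\<mu> k)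
           / ennreal (sqrt (real n))) \<longlonglongrightarrow> 0))
    \<and> (AE \<zeta> in quenched_zeta_law \<mu>. (\<lambda>n. (\<Sum>k<n. real (\<zeta> k)) / real n) \<longlonglongrightarrow> \<sigma>2 / 2)
    \<and> ((\<lambda>\<epsilon>. limsup (\<lambda>n. (\<Sum>k = 0..n. shape_modulus (\<mu> k) \<epsilon>) / of_nat n)) \<longlongrightarrow> 0) (at_right 0)"
proof -

  \<comment> \<open>From the environment to a single law\<close>
  note \<Lambda> = assms(1,2)
  interpret prob_space \<Lambda> by (rule \<Lambda>)
  have env: "environment_law \<Lambda> = PiM UNIV (\<lambda>_. \<Lambda>)" by (simp add: environment_law_def)
  note moment_meas = nn_integral_measurable_prob_measures_nat[OF \<Lambda>(2)]
  note [measurable] = binom_moment_measurable[OF \<Lambda>(2)] shape_bound_measurable[OF \<Lambda>(2)]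
  have space: "AE \<nu> in \<Lambda>. \<nu> \<in> space prob_measures_nat"
    using AE_space[of \<Lambda>] sets_eq_imp_space_eq[OF \<Lambda>(2)] by simp
  have mean_meas: "mean \<in> borel_measurable \<Lambda>" unfolding mean_def by (rule moment_meas)
  \<comment> \<open>The hypothesis concerns coordinate 0, whose distribution is
    \<open>\<Lambda>\<close>; through \<open>\<Lambda>\<close> it passes to all coordinates.\<close>
  have "distr (environment_law \<Lambda>) \<Lambda> (\<lambda>\<mu>. \<mu> 0) = \<Lambda>"
    unfolding env using \<Lambda>(1) by (intro distr_PiM_component) auto
  moreover have "AE \<nu> in distr (environment_law \<Lambda>) \<Lambda> (\<lambda>\<mu>. \<mu> 0). mean \<nu> = 1"
    using assms(3) mean_meas unfolding env by (subst AE_distr_iff) auto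
  ultimately have mean1: "AE \<nu> in \<Lambda>. mean \<nu> = 1" by (simp only:)
  have coord: "AE \<mu> in environment_law \<Lambda>. \<forall>k. P (\<mu> k)" if "AE \<nu> in \<Lambda>. P \<nu>" for P
    unfolding AE_all_countable env using \<Lambda>(1) that by (auto intro: AE_PiM_component)
  have slln: "AE \<mu> in environment_law \<Lambda>. (\<forall>k. f (\<mu> k) < \<infinity>) \<and>
      (\<lambda>n. (\<Sum>k<n. enn2real (f (\<mu> k))) / real n) \<longlonglongrightarrow> enn2real (\<integral>\<^sup>+\<nu>. f \<nu> \<partial>\<Lambda>)"
    if "f \<in> borel_measurable \<Lambda>" "(\<integral>\<^sup>+\<nu>. f \<nu> \<partial>\<Lambda>) < \<infinity>" for f
    unfolding env by (intro strong_law_iid \<Lambda> that)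

  \<comment> \<open>The annealed binomial moment\<close>
  have "ennreal \<sigma>2 = (\<integral>\<^sup>+\<mu>. 2 * binom_moment (\<mu> 0) \<partial>environment_law \<Lambda>)"
    unfolding assms(4)[symmetric]
    by (rule nn_integral_cong_AE)
      (use coord[OF space] coord[OF mean1] in eventually_elim, simp add: var_eq_binom_moment)
  also have "\<dots> = 2 * (\<integral>\<^sup>+\<nu>. binom_moment \<nu> \<partial>\<Lambda>)"
    using \<Lambda>(1) unfolding env
    by (subst nn_integral_PiM_component[of "\<lambda>_. \<Lambda>" "\<lambda>\<nu>. 2 * binom_moment \<nu>" 0])
      (auto simp: nn_integral_cmult)
  finally have two_B: "2 * (\<integral>\<^sup>+\<nu>. binom_moment \<nu> \<partial>\<Lambda>) = ennreal \<sigma>2" by simp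
  then have B_fin: "(\<integral>\<^sup>+\<nu>. binom_moment \<nu> \<partial>\<Lambda>) < \<infinity>"
    by (metis ennreal_less_top ennreal_mult_eq_top_iff infinity_ennreal_def less_top zero_neq_numeral)
  have B_eq: "enn2real (\<integral>\<^sup>+\<nu>. binom_moment \<nu> \<partial>\<Lambda>) = \<sigma>2 / 2"
  proof -
    have "2 * enn2real (\<integral>\<^sup>+\<nu>. binom_moment \<nu> \<partial>\<Lambda>) = \<sigma>2"
      using arg_cong[OF two_B, of enn2real] assms(5) by (simp add: enn2real_mult)
    then show ?thesis by simp
  qed
  have B_nz: "(\<integral>\<^sup>+\<nu>. binom_moment \<nu> \<partial>\<Lambda>) \<noteq> 0" using two_B assms(5) by auto

  \<comment> \<open>The annealed mass at 0\<close>
  define p where "p = (\<integral>\<^sup>+\<nu>. emeasure \<nu> {0} \<partial>\<Lambda>)"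
  have p_meas: "(\<lambda>\<nu>. emeasure \<nu> {0}) \<in> borel_measurable \<Lambda>"
  proof -
    have "(\<lambda>\<nu>. emeasure \<nu> {0}) \<in> borel_measurable \<Lambda> \<longleftrightarrow>
        (\<lambda>\<nu>. \<integral>\<^sup>+i. indicator {0::nat} i \<partial>\<nu>) \<in> borel_measurable \<Lambda>"
      using sets_eq_imp_space_eq[OF \<Lambda>(2)]
      by (intro measurable_cong) (auto dest: in_space_prob_measures_nat)
    then show ?thesis using moment_meas by blast
  qed
  have "p \<le> (\<integral>\<^sup>+\<nu>. 1 \<partial>\<Lambda>)"
    unfolding p_def using space
    by (intro nn_integral_mono_AE)
      (auto elim!: eventually_mono dest!: in_space_prob_measures_nat(1) simp: prob_space.emeasure_le_1)
  also have "\<dots> = 1" by (simp add: emeasure_space_1)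
  finally have p_fin: "p < \<infinity>" by (simp add: le_less_trans)
  have p_pos: "0 < enn2real p"
    using emeasure_zero_pos[OF \<Lambda>(2) mean1 B_nz] p_fin unfolding p_def
    by (simp add: enn2real_positive_iff zero_less_iff_neq_zero)

  \<comment> \<open>Truncated second moments\<close>
  define T where "T a \<nu> = (\<integral>\<^sup>+i. ennreal ((real i)\<^sup>2) * indicator {i. a \<le> (real i)\<^sup>2} i \<partial>\<nu>)" for a \<nu>
  have T_meas: "T a \<in> borel_measurable \<Lambda>" for a unfolding T_def by (rule moment_meas)
  have "(\<integral>\<^sup>+\<nu>. \<integral>\<^sup>+i. of_nat (i\<^sup>2) \<partial>\<nu> \<partial>\<Lambda>) = (\<integral>\<^sup>+\<nu>. 2 * binom_moment \<nu> + 1 \<partial>\<Lambda>)"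
    by (rule nn_integral_cong_AE) (use space mean1 in eventually_elim, rule second_moment_eq)
  also have "\<dots> = ennreal \<sigma>2 + 1"
    by (simp add: nn_integral_add nn_integral_cmult two_B emeasure_space_1)
  also have "\<dots> < \<infinity>" by simp
  finally have sq_fin: "(\<integral>\<^sup>+\<nu>. \<integral>\<^sup>+i. of_nat (i\<^sup>2) \<partial>\<nu> \<partial>\<Lambda>) < \<infinity>" .
  have trunc_le: "ennreal ((real i)\<^sup>2) * indicator A i \<le> of_nat (i\<^sup>2)" for i and A :: "nat set"
    by (simp add: indicator_def ennreal_of_nat_eq_real_of_nat)
  have T_fin: "(\<integral>\<^sup>+\<nu>. T a \<nu> \<partial>\<Lambda>) < \<infinity>" for a
    using sq_fin unfolding T_def
    by (rule le_less_trans[rotated]) (intro nn_integral_mono trunc_le)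
  have "(\<lambda>L. \<integral>\<^sup>+\<nu>. T (real L) \<nu> \<partial>\<Lambda>) \<longlonglongrightarrow> 0"
    unfolding T_def
  proof (rule nn_integral_annealed_tendsto_zero[OF \<Lambda>(2) trunc_le sq_fin])
    fix i :: nat
    \<comment> \<open>The truncated square is 0 as soon as \<open>L\<close> exceeds
      \<open>i^2\<close>.\<close>
    have "\<forall>\<^sub>F L in sequentially. Suc (i\<^sup>2) \<le> L" by (rule eventually_ge_at_top)
    then have "\<forall>\<^sub>F L in sequentially. ennreal ((real i)\<^sup>2) * indicator {i. real L \<le> (real i)\<^sup>2} i = 0"
    proof eventually_elim
      case (elim L)
      then have "real (i\<^sup>2) < real L" by (simp only: of_nat_less_iff)
      then show ?case by simp
    qed
    then show "(\<lambda>L. ennreal ((real i)\<^sup>2) * indicator {i. real L \<le> (real i)\<^sup>2} i) \<longlonglongrightarrow> 0"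
      by (rule tendsto_eventually)
  qed
  then have T_lim: "(\<lambda>L. enn2real (\<integral>\<^sup>+\<nu>. T (real L) \<nu> \<partial>\<Lambda>)) \<longlonglongrightarrow> 0"
    by (intro tendsto_enn2real) simp_all

  \<comment> \<open>The annealed shape bound\<close>
  define r where "r m = 1 - 1 / real (Suc m)" for m
  have B_AE: "AE \<nu> in \<Lambda>. binom_moment \<nu> < \<infinity>"
    using nn_integral_PInf_AE[of binom_moment \<Lambda>] B_fin by (simp add: less_top)
  have four_B_fin: "(\<integral>\<^sup>+\<nu>. 4 * binom_moment \<nu> \<partial>\<Lambda>) < \<infinity>"
    using B_fin by (simp add: nn_integral_cmult ennreal_mult_less_top)
  have G_le: "shape_bound a \<nu> \<le> 4 * binom_moment \<nu>" for a \<nu> by (simp add: shape_bound_def)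
  have G_fin: "(\<integral>\<^sup>+\<nu>. shape_bound a \<nu> \<partial>\<Lambda>) < \<infinity>" for a
    using four_B_fin by (rule le_less_trans[rotated]) (intro nn_integral_mono G_le)
  have "(\<lambda>m. \<integral>\<^sup>+\<nu>. shape_bound (r m) \<nu> \<partial>\<Lambda>) \<longlonglongrightarrow> (\<integral>\<^sup>+\<nu>. 0 \<partial>\<Lambda>)"
  proof (rule nn_integral_dominated_convergence[where w = "\<lambda>\<nu>. 4 * binom_moment \<nu>"])
    show "AE \<nu> in \<Lambda>. (\<lambda>m. shape_bound (r m) \<nu>) \<longlonglongrightarrow> 0"
      unfolding r_def using space mean1 B_AE by eventually_elim (rule shape_bound_tendsto_zero)
  qed (use four_B_fin G_le in auto)
  then have G_lim: "(\<lambda>m. enn2real (\<integral>\<^sup>+\<nu>. shape_bound (r m) \<nu> \<partial>\<Lambda>)) \<longlonglongrightarrow> 0"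
    by (intro tendsto_enn2real) simp_all

  \<comment> \<open>Almost sure limits of the averages\<close>
  have slln_T: "AE \<mu> in environment_law \<Lambda>. \<forall>L::nat. (\<forall>k. T (real L) (\<mu> k) < \<infinity>) \<and>
      (\<lambda>n. (\<Sum>k<n. enn2real (T (real L) (\<mu> k))) / real n) \<longlonglongrightarrow> enn2real (\<integral>\<^sup>+\<nu>. T (real L) \<nu> \<partial>\<Lambda>)"
    \<comment> \<open>Restricting to integer levels \<open>L\<close> keeps the number of exceptional
      null sets countable.\<close>
    unfolding AE_all_countable by (intro allI slln T_meas T_fin)
  have slln_G: "AE \<mu> in environment_law \<Lambda>. \<forall>m. (\<forall>k. shape_bound (r m) (\<mu> k) < \<infinity>) \<and>
      (\<lambda>n. (\<Sum>k<n. enn2real (shape_bound (r m) (\<mu> k))) / real n)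
        \<longlonglongrightarrow> enn2real (\<integral>\<^sup>+\<nu>. shape_bound (r m) \<nu> \<partial>\<Lambda>)"
    unfolding AE_all_countable by (intro allI slln G_fin) measurable
  have slln_B: "AE \<mu> in environment_law \<Lambda>. (\<forall>k. binom_moment (\<mu> k) < \<infinity>) \<and>
      (\<lambda>n. (\<Sum>k<n. enn2real (binom_moment (\<mu> k))) / real n) \<longlonglongrightarrow> \<sigma>2 / 2"
    using slln[OF _ B_fin] by (simp add: B_eq)
  have slln_p: "AE \<mu> in environment_law \<Lambda>. (\<forall>k. emeasure (\<mu> k) {0} < \<infinity>) \<and>
      (\<lambda>n. (\<Sum>k<n. enn2real (emeasure (\<mu> k) {0})) / real n) \<longlonglongrightarrow> enn2real p"
    unfolding p_def by (intro slln p_meas) (use p_fin in \<open>simp add: p_def\<close>)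
  have zeta: "AE \<mu> in environment_law \<Lambda>. AE \<zeta> in quenched_zeta_law \<mu>.
      (\<lambda>n. (\<Sum>k<n. real (\<zeta> k)) / real n) \<longlonglongrightarrow> \<sigma>2 / 2"
    using quenched_zeta_strong_law[OF \<Lambda> mean1 B_fin] by (simp add: B_eq)

  \<comment> \<open>The five conditions in almost every environment\<close>
  show ?thesis
  \<comment> \<open>The constant is the annealed mass at 0, fixed before the environment is drawn;
    the lower limit turns out to be a limit equal to it.\<close>
  proof (intro exI[of _ "enn2real p"] conjI p_pos)
    show "AE \<mu> in environment_law \<Lambda>.
      (0 < \<sigma>2 \<and> (\<lambda>n. (\<Sum>k<n. var (\<mu> k)) / of_nat n) \<longlonglongrightarrow> ennreal \<sigma>2)
    \<and> (\<forall>a b :: real. 0 \<le> a \<longrightarrow> a < b \<longrightarrow>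
         ereal (enn2real p) \<le> liminf (\<lambda>k. ereal
           ((\<Sum>j = nat \<lfloor>a * real k\<rfloor>..nat \<lfloor>b * real k\<rfloor>. measure (\<mu> j) {0}) / ((b - a) * real k))))
    \<and> (\<exists>h :: nat \<Rightarrow> real. filterlim h at_top sequentially \<and>
         (\<forall>\<epsilon>>0. (\<lambda>n. (\<Sum>k = 0..nat \<lfloor>h n * sqrt (real n)\<rfloor>.
             \<integral>\<^sup>+ i. ennreal ((real i)\<^sup>2) * indicator {i. \<epsilon> * real n \<le> (real i)\<^sup>2} i \<partial>\<mu> k)
           / ennreal (sqrt (real n))) \<longlonglongrightarrow> 0))
    \<and> (AE \<zeta> in quenched_zeta_law \<mu>. (\<lambda>n. (\<Sum>k<n. real (\<zeta> k)) / real n) \<longlonglongrightarrow> \<sigma>2 / 2)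
    \<and> ((\<lambda>\<epsilon>. limsup (\<lambda>n. (\<Sum>k = 0..n. shape_modulus (\<mu> k) \<epsilon>) / of_nat n)) \<longlongrightarrow> 0) (at_right 0)"
      \<comment> \<open>On the intersection of these almost sure events the argument is
        deterministic, so all real \<open>a\<close>, \<open>b\<close> and \<open>\<epsilon>\<close>
        are covered by one null set.\<close>
      using coord[OF space] coord[OF mean1] slln_B slln_p slln_T slln_G zeta
    proof eventually_elim
      case (elim \<mu>)
      have \<mu>: "\<mu> k \<in> space prob_measures_nat" "mean (\<mu> k) = 1" "binom_moment (\<mu> k) < \<infinity>" for k
        using elim by auto
      have "(\<lambda>n. (\<Sum>k<n. var (\<mu> k)) / of_nat n) \<longlonglongrightarrow> ennreal \<sigma>2"
      proof (rule Lim_transform_eventually)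
        have "(\<lambda>n. 2 * ((\<Sum>k<n. enn2real (binom_moment (\<mu> k))) / real n)) \<longlonglongrightarrow> 2 * (\<sigma>2 / 2)"
          using elim(3) by (intro tendsto_mult tendsto_const) auto
        then show "(\<lambda>n. ennreal ((\<Sum>k<n. enn2real (var (\<mu> k))) / real n)) \<longlonglongrightarrow> ennreal \<sigma>2"
          by (intro tendsto_ennrealI)
            (simp add: var_eq_binom_moment[OF \<mu>(1,2)] enn2real_mult sum_distrib_left)
        show "\<forall>\<^sub>F n in sequentially. ennreal ((\<Sum>k<n. enn2real (var (\<mu> k))) / real n) = (\<Sum>k<n. var (\<mu> k)) / of_nat n"
          using eventually_gt_at_top[of 0]
        proof eventually_elim
          case (elim n)
          then show ?case
            unfolding ennreal_of_nat_eq_real_of_nat using \<mu>(3)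
            by (intro sum_divide_ennreal[symmetric])
              (auto simp: var_eq_binom_moment[OF \<mu>(1,2)] ennreal_mult_less_top)
        qed
      qed
      moreover have "ereal (enn2real p) \<le> liminf (\<lambda>k. ereal
           ((\<Sum>j = nat \<lfloor>a * real k\<rfloor>..nat \<lfloor>b * real k\<rfloor>. measure (\<mu> j) {0}) / ((b - a) * real k)))"
        if "0 \<le> a" "a < b" for a b :: real
      proof -
        have "(\<lambda>n. (\<Sum>j<n. measure (\<mu> j) {0}) / real n) \<longlonglongrightarrow> enn2real p"
          using elim(4) by (simp add: measure_def)
        from window_average_tendsto[OF this that] show ?thesis
          by (intro eq_refl lim_imp_Liminf[symmetric] tendsto_ereal) auto
      qed
      moreover have "\<exists>h :: nat \<Rightarrow> real. filterlim h at_top sequentially \<and>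
         (\<forall>\<epsilon>>0. (\<lambda>n. (\<Sum>k = 0..nat \<lfloor>h n * sqrt (real n)\<rfloor>. T (\<epsilon> * real n) (\<mu> k)) / ennreal (sqrt (real n)))
           \<longlonglongrightarrow> 0)"
        unfolding T_def
      proof (rule truncated_second_moment_windows[OF _ _ T_lim], fold T_def)
        show "T 0 (\<mu> k) < \<infinity>" for k using spec[OF elim(5), of 0] by simp
      qed (use elim(5) in auto)
      moreover have "((\<lambda>\<epsilon>. limsup (\<lambda>n. (\<Sum>k = 0..n. shape_modulus (\<mu> k) \<epsilon>) / of_nat n)) \<longlongrightarrow> 0) (at_right 0)"
        using elim(6) unfolding r_def
        by (intro shape_modulus_limsup[OF \<mu> _ _ G_lim[unfolded r_def]]) auto
      ultimately show ?case using elim(7) assms(5) unfolding T_def by blast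
    qed
  qed
qed

end
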